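(* If $\psi_{1}$ and $\psi_{2}$ are conformal-Killing $2$-forms on an Einstein manifold $(M,g)$, then $$[\psi_{1},\psi_{2}]:=\frac12\left(L_{\delta\psi_{1}}\psi_{2}-L_{\delta\psi_{2}}\psi_{1}\right)$$ is also conformal-Killing and $$\delta[\psi_{1},\psi_{2}]=[\delta\psi_{1},\delta\psi_{2}].$$
   Context: Let $(M,g)$ be a Riemannian manifold of dimension $m$ with Levi-Civita connection $\nabla$. Tangent vectors are identified with $1$-forms using $g$; in particular the codifferential $\delta\psi=-\sum_k i_{e_k}\nabla_{e_k}\psi$ of a $2$-form ($\{e_k\}$ a local orthonormal frame) is regarded as a vector field. A $2$-form $\psi$ is conformal-Killing if $\nabla_Y\psi=\frac13 i_Yd\psi-\frac{1}{m-1}Y\wedge\delta\psi$ for all $Y\in TM$. $L$ denotes the Lie derivative, and $[\delta\psi_1,\delta\psi_2]$ is the Lie bracket of vector fields. *)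

theory Defs
  imports "HOL-Analysis.Analysis"
begin

text \<open>
  A smooth manifold of dimension \<open>DIM('e)\<close> is a Hausdorff second-countable space with a smooth
  atlas. Tensor fields are given by their local representatives: one function on the coordinate
  domain of each chart, subject to the tensor transformation law under changes of charts. The
  differential operators below act on such local representatives; the argument \<open>x\<close> is always the
  coordinate of a point, and \<open>u\<close>, \<open>v\<close>, \<open>w\<close> are coordinate vectors, which double as the vector
  fields with constant coefficients.
\<close>

text \<open>Meant for open \<open>S\<close> only: \<open>differentiable_on\<close> is relative to \<open>S\<close>, the derivative at \<open>x\<close> is not.\<close>

primrec Ck_on :: "nat \<Rightarrow> 'a::euclidean_space set \<Rightarrow> ('a \<Rightarrow> 'b::real_normed_vector) \<Rightarrow> bool" where
  "Ck_on 0 S f \<longleftrightarrow> continuous_on S f"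
| "Ck_on (Suc k) S f \<longleftrightarrow>
     f differentiable_on S \<and> (\<forall>v. Ck_on k S (\<lambda>x. frechet_derivative f (at x) v))"

definition smooth_on :: "'a::euclidean_space set \<Rightarrow> ('a \<Rightarrow> 'b::real_normed_vector) \<Rightarrow> bool" where
  "smooth_on S f \<longleftrightarrow> (\<forall>k. Ck_on k S f)"

type_synonym ('p, 'e) chart = "'p set \<times> ('p \<Rightarrow> 'e)"

definition coord_dom :: "('p, 'e) chart \<Rightarrow> 'e set" where
  "coord_dom c = snd c ` fst c"

definition overlap :: "('p, 'e) chart \<Rightarrow> ('p, 'e) chart \<Rightarrow> 'e set" where
  "overlap c c' = snd c ` (fst c \<inter> fst c')"

definition transition :: "('p, 'e) chart \<Rightarrow> ('p, 'e) chart \<Rightarrow> 'e \<Rightarrow> 'e" where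
  "transition c c' = snd c' \<circ> inv_into (fst c) (snd c)"

definition smooth_manifold :: "'p topology \<Rightarrow> ('p, 'e::euclidean_space) chart set \<Rightarrow> bool" where
  "smooth_manifold M A \<longleftrightarrow>
     Hausdorff_space M \<and> second_countable M \<and>
     (\<forall>c\<in>A. openin M (fst c) \<and> open (coord_dom c) \<and>
        homeomorphic_map (subtopology M (fst c)) (top_of_set (coord_dom c)) (snd c)) \<and>
     (\<Union>c\<in>A. fst c) = topspace M \<and>
     (\<forall>c\<in>A. \<forall>c'\<in>A. smooth_on (overlap c c') (transition c c'))"

type_synonym 'e local_vector_field = "'e \<Rightarrow> 'e"
type_synonym 'e local_tensor2 = "'e \<Rightarrow> 'e \<Rightarrow> 'e \<Rightarrow> real"
type_synonym ('p, 'e) tensor2 = "('p, 'e) chart \<Rightarrow> 'e local_tensor2"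

definition tensor2_field :: "('p, 'e::euclidean_space) chart set \<Rightarrow> ('p, 'e) tensor2 \<Rightarrow> bool" where
  "tensor2_field A b \<longleftrightarrow>
     (\<forall>c\<in>A. (\<forall>x\<in>coord_dom c. bilinear (b c x)) \<and>
        (\<forall>u v. smooth_on (coord_dom c) (\<lambda>x. b c x u v))) \<and>
     (\<forall>c\<in>A. \<forall>c'\<in>A. \<forall>x\<in>overlap c c'. \<forall>u v.
        b c x u v = b c' (transition c c' x)
          (frechet_derivative (transition c c') (at x) u)
          (frechet_derivative (transition c c') (at x) v))"

definition two_form :: "('p, 'e::euclidean_space) chart set \<Rightarrow> ('p, 'e) tensor2 \<Rightarrow> bool" where
  "two_form A \<psi> \<longleftrightarrow> tensor2_field A \<psi> \<and> (\<forall>c\<in>A. \<forall>x\<in>coord_dom c. \<forall>u. \<psi> c x u u = 0)"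

definition riemannian_metric :: "('p, 'e::euclidean_space) chart set \<Rightarrow> ('p, 'e) tensor2 \<Rightarrow> bool" where
  "riemannian_metric A g \<longleftrightarrow> tensor2_field A g \<and>
     (\<forall>c\<in>A. \<forall>x\<in>coord_dom c.
        (\<forall>u v. g c x u v = g c x v u) \<and> (\<forall>u. u \<noteq> 0 \<longrightarrow> g c x u u > 0))"

definition riemannian_manifold ::
    "'p topology \<Rightarrow> ('p, 'e::euclidean_space) chart set \<Rightarrow> ('p, 'e) tensor2 \<Rightarrow> bool" where
  "riemannian_manifold M A g \<longleftrightarrow> smooth_manifold M A \<and> riemannian_metric A g"

text \<open>
  The Christoffel map of the Levi-Civita connection: \<open>christoffel G x u v\<close> is the value at \<open>x\<close> of
  the covariant derivative of the constant field \<open>v\<close> in direction \<open>u\<close>. Symmetry says that the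
  connection is torsion-free, and the last condition that it is metric.
\<close>

definition christoffel :: "'e::euclidean_space local_tensor2 \<Rightarrow> 'e \<Rightarrow> 'e \<Rightarrow> 'e \<Rightarrow> 'e" where
  "christoffel G x = (THE \<Gamma>. bilinear \<Gamma> \<and> (\<forall>u v. \<Gamma> u v = \<Gamma> v u) \<and>
     (\<forall>u v w. frechet_derivative (\<lambda>y. G y v w) (at x) u = G x (\<Gamma> u v) w + G x v (\<Gamma> u w)))"

definition nabla_vec ::
    "'e::euclidean_space local_tensor2 \<Rightarrow> 'e \<Rightarrow> 'e local_vector_field \<Rightarrow> 'e local_vector_field" where
  "nabla_vec G u X x = frechet_derivative X (at x) u + christoffel G x u (X x)"

definition nabla_form ::
    "'e::euclidean_space local_tensor2 \<Rightarrow> 'e \<Rightarrow> 'e local_tensor2 \<Rightarrow> 'e local_tensor2" where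
  "nabla_form G u \<psi> x v w =
     frechet_derivative (\<lambda>y. \<psi> y v w) (at x) u
       - \<psi> x (nabla_vec G u (\<lambda>_. v) x) w - \<psi> x v (nabla_vec G u (\<lambda>_. w) x)"

text \<open>No bracket term appears in the curvature, because constant fields commute.\<close>

definition curvature :: "'e::euclidean_space local_tensor2 \<Rightarrow> 'e \<Rightarrow> 'e \<Rightarrow> 'e \<Rightarrow> 'e \<Rightarrow> 'e" where
  "curvature G x u v w =
     nabla_vec G u (nabla_vec G v (\<lambda>_. w)) x - nabla_vec G v (nabla_vec G u (\<lambda>_. w)) x"

text \<open>
  The Ricci tensor is the trace of \<open>\<lambda>u. curvature G x u v w\<close>; the trace of an endomorphism may be
  computed in the standard basis of the coordinate space, which need not be orthonormal for \<open>G x\<close>.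
\<close>

definition ricci :: "'e::euclidean_space local_tensor2 \<Rightarrow> 'e local_tensor2" where
  "ricci G x v w = (\<Sum>b\<in>Basis. curvature G x b v w \<bullet> b)"

definition einstein :: "('p, 'e::euclidean_space) chart set \<Rightarrow> ('p, 'e) tensor2 \<Rightarrow> bool" where
  "einstein A g \<longleftrightarrow>
     (\<exists>a::real. \<forall>c\<in>A. \<forall>x\<in>coord_dom c. \<forall>v w. ricci (g c) x v w = a * g c x v w)"

definition ext_deriv :: "'e::euclidean_space local_tensor2 \<Rightarrow> 'e \<Rightarrow> 'e \<Rightarrow> 'e \<Rightarrow> 'e \<Rightarrow> real" where
  "ext_deriv \<psi> x u v w =
     frechet_derivative (\<lambda>y. \<psi> y v w) (at x) u
       + frechet_derivative (\<lambda>y. \<psi> y w u) (at x) v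
       + frechet_derivative (\<lambda>y. \<psi> y u v) (at x) w"

definition orthonormal_basis :: "'e::euclidean_space local_tensor2 \<Rightarrow> 'e \<Rightarrow> 'e set \<Rightarrow> bool" where
  "orthonormal_basis G x E \<longleftrightarrow> finite E \<and> card E = DIM('e) \<and>
     (\<forall>e\<in>E. \<forall>f\<in>E. G x e f = (if e = f then 1 else 0))"

text \<open>
  The vector field metrically dual to \<open>- (\<Sum>k. i\<^bsub>e\<^sub>k\<^esub> \<nabla>\<^bsub>e\<^sub>k\<^esub> \<psi>)\<close>. As the summand is tensorial in \<open>e\<^sub>k\<close>,
  only the values of the frame at \<open>x\<close> matter, and the sum is the same for all orthonormal bases.
\<close>

definition codiff ::
    "'e::euclidean_space local_tensor2 \<Rightarrow> 'e local_tensor2 \<Rightarrow> 'e local_vector_field" where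
  "codiff G \<psi> x = (THE d. \<forall>E. orthonormal_basis G x E \<longrightarrow>
     (\<forall>v. G x d v = - (\<Sum>e\<in>E. nabla_form G e \<psi> x e v)))"

text \<open>The wedge product of the 1-forms metrically dual to \<open>y\<close> and \<open>z\<close>.\<close>

definition wedge :: "'e::euclidean_space local_tensor2 \<Rightarrow> 'e \<Rightarrow> 'e \<Rightarrow> 'e \<Rightarrow> 'e \<Rightarrow> 'e \<Rightarrow> real" where
  "wedge G x y z u v = G x y u * G x z v - G x y v * G x z u"

definition lie_bracket ::
    "'e::euclidean_space local_vector_field \<Rightarrow> 'e local_vector_field \<Rightarrow> 'e local_vector_field" where
  "lie_bracket X Y x = frechet_derivative Y (at x) (X x) - frechet_derivative X (at x) (Y x)"

definition lie_deriv ::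
    "'e::euclidean_space local_vector_field \<Rightarrow> 'e local_tensor2 \<Rightarrow> 'e local_tensor2" where
  "lie_deriv X \<psi> x u v =
     frechet_derivative (\<lambda>y. \<psi> y u v) (at x) (X x)
       - \<psi> x (lie_bracket X (\<lambda>_. u) x) v - \<psi> x u (lie_bracket X (\<lambda>_. v) x)"

text \<open>
  In dimension 1 the coefficient \<open>1 / (m - 1)\<close> is 0 by convention; this is harmless, since all
  2-forms then vanish.
\<close>

definition conformal_killing ::
    "('p, 'e::euclidean_space) chart set \<Rightarrow> ('p, 'e) tensor2 \<Rightarrow> ('p, 'e) tensor2 \<Rightarrow> bool" where
  "conformal_killing A g \<psi> \<longleftrightarrow> two_form A \<psi> \<and>
     (\<forall>c\<in>A. \<forall>x\<in>coord_dom c. \<forall>y u v.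
        nabla_form (g c) y (\<psi> c) x u v =
          1 / 3 * ext_deriv (\<psi> c) x y u v
          - 1 / (real DIM('e) - 1) * wedge (g c) x y (codiff (g c) (\<psi> c) x) u v)"

definition form_bracket ::
    "('p, 'e::euclidean_space) tensor2 \<Rightarrow> ('p, 'e) tensor2 \<Rightarrow> ('p, 'e) tensor2 \<Rightarrow> ('p, 'e) tensor2" where
  "form_bracket g \<psi>\<^sub>1 \<psi>\<^sub>2 c x u v =
     1 / 2 * (lie_deriv (codiff (g c) (\<psi>\<^sub>1 c)) (\<psi>\<^sub>2 c) x u v
              - lie_deriv (codiff (g c) (\<psi>\<^sub>2 c)) (\<psi>\<^sub>1 c) x u v)"

end

(* For a two-form psi, the conformal-Killing equation is equivalent to its restriction to the diagonal,
   nabla_Y psi (Y, v) = - (g(Y, Y) xi(v) - g(Y, v) xi(Y)) / (m - 1), and the vector field xi is then the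
   codifferential of psi. Contracting the Ricci identity for psi over e, Y, e, Y on an Einstein manifold
   gives (m - 2) g(nabla_Y xi, Y) + g(Y, Y) div xi = 0, so xi is Killing if m > 2 and divergence-free if
   m = 2. The Lie derivative L along xi satisfies nabla_Y (L psi) = L (nabla psi)(Y) + C_Y psi,
   where C = L nabla acts on forms as a derivation. For m > 2, C vanishes since xi is Killing; for
   m = 2, every C_Y is trace-free and so annihilates two-forms. Applying L_{delta psi_1} to the
   diagonal equation of psi_2 therefore shows that L_{delta psi_1} psi_2 satisfies the diagonal equation
   with the vector field [delta psi_1, delta psi_2]; antisymmetrising gives the theorem. *)

theory Submission
  imports Defs
begin

text \<open>The codifferential is a definite description, which shows neither that it is smooth nor
  how it changes between charts. The argument therefore runs with any vector field xi that satisfies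
  the diagonal equation. In dimension at least two this equation determines xi algebraically, after
  division by a Gram determinant; smoothness and naturality follow from that. The diagonal removes d
  psi because d psi(Y, Y, v) = 0. The factor 1/3 returns on the way back: polarisation makes the
  three cyclic terms of d psi equal up to metric terms. In the Ricci contraction the Einstein
  condition turns one curvature sum into a multiple of psi(Y, Y) = 0. The other sum pairs the
  self-adjoint map e -> R(e, Y)Y with an alternating form. Tracing the result over Y gives 2(m - 1)
  div xi = 0. On a surface L g need not vanish, but it is trace-free. The error it causes in the
  diagonal equation is a Kulkarni-Nomizu product with g, which is zero in dimension two.\<close>

subsection \<open>Calculus of smooth functions\<close>

abbreviation D :: "('a::euclidean_space \<Rightarrow> 'b::real_normed_vector) \<Rightarrow> 'a \<Rightarrow> 'a \<Rightarrow> 'b" where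
  "D f x \<equiv> frechet_derivative f (at x)"

lemma D_eqI: "(f has_derivative f') (at x) \<Longrightarrow> D f x u = f' u"
  by (metis frechet_derivative_at)

lemma D_cong:
  assumes "open S" "x \<in> S" "\<And>y. y \<in> S \<Longrightarrow> f y = g y"
  shows "D f x = D g x"
proof -
  have "(f has_derivative f') (at x) \<longleftrightarrow> (g has_derivative f') (at x)" for f'
    using assms by (metis has_derivative_transform_within_open)
  then show ?thesis
    by (simp add: frechet_derivative_def)
qed

lemma differentiable_cong:
  assumes "open S" "x \<in> S" "\<And>y. y \<in> S \<Longrightarrow> f y = g y" "f differentiable (at x)"
  shows "g differentiable (at x)"
  using assms by (metis differentiable_def has_derivative_transform_within_open)

lemma D_works: "f differentiable (at x) \<Longrightarrow> (f has_derivative D f x) (at x)"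
  by (simp add: frechet_derivative_works)

lemma D_bounded_linear:
  assumes "bounded_linear L" "f differentiable (at x)"
  shows "D (\<lambda>y. L (f y)) x u = L (D f x u)"
  by (rule D_eqI) (rule bounded_linear.has_derivative[OF assms(1) D_works[OF assms(2)]])

lemma D_bilinear:
  assumes "bounded_bilinear B" "f differentiable (at x)" "g differentiable (at x)"
  shows "D (\<lambda>y. B (f y) (g y)) x u = B (f x) (D g x u) + B (D f x u) (g x)"
  by (rule D_eqI) (rule bounded_bilinear.FDERIV[OF assms(1) D_works[OF assms(2)] D_works[OF assms(3)]])

lemma differentiable_bilinear:
  fixes f :: "'a::euclidean_space \<Rightarrow> 'b::real_normed_vector"
  assumes "bounded_bilinear B" "f differentiable (at x)" "g differentiable (at x)"
  shows "(\<lambda>y. B (f y) (g y)) differentiable (at x)"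
  using bounded_bilinear.FDERIV[OF assms(1) D_works[OF assms(2)] D_works[OF assms(3)]]
  by (auto simp: differentiable_def)

lemma D_add:
  assumes "f differentiable (at x)" "g differentiable (at x)"
  shows "D (\<lambda>y. f y + g y) x u = D f x u + D g x u"
  by (rule D_eqI) (intro has_derivative_add D_works assms)

lemma D_diff:
  assumes "f differentiable (at x)" "g differentiable (at x)"
  shows "D (\<lambda>y. f y - g y) x u = D f x u - D g x u"
  by (rule D_eqI) (intro has_derivative_diff D_works assms)

lemma D_minus:
  assumes "f differentiable (at x)"
  shows "D (\<lambda>y. - f y) x u = - D f x u"
  by (rule D_eqI) (intro has_derivative_minus D_works assms)

lemma D_cmult:
  fixes f :: "'a::euclidean_space \<Rightarrow> real"
  assumes "f differentiable (at x)"
  shows "D (\<lambda>y. a * f y) x u = a * D f x u"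
  using D_bounded_linear[OF bounded_linear_mult_right assms] .

lemma D_mult:
  fixes f g :: "'a::euclidean_space \<Rightarrow> real"
  assumes "f differentiable (at x)" "g differentiable (at x)"
  shows "D (\<lambda>y. f y * g y) x u = f x * D g x u + D f x u * g x"
  using D_bilinear[OF bounded_bilinear_mult assms] .

lemma D_scaleR:
  fixes f :: "'a::euclidean_space \<Rightarrow> real"
  assumes "f differentiable (at x)" "g differentiable (at x)"
  shows "D (\<lambda>y. f y *\<^sub>R g y) x u = f x *\<^sub>R D g x u + D f x u *\<^sub>R g x"
  using D_bilinear[OF bounded_bilinear_scaleR assms] .

lemma D_sum:
  assumes "\<And>i. i \<in> I \<Longrightarrow> f i differentiable (at x)"
  shows "D (\<lambda>y. \<Sum>i\<in>I. f i y) x u = (\<Sum>i\<in>I. D (f i) x u)"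
  by (rule D_eqI) (intro has_derivative_sum D_works assms)

lemma D_linear: "f differentiable (at x) \<Longrightarrow> linear (D f x)"
  by (rule linear_frechet_derivative)

lemma Ck_on_cong:
  assumes "open S" "\<And>x. x \<in> S \<Longrightarrow> f x = g x" "Ck_on k S f"
  shows "Ck_on k S g"
  using assms(2,3)
proof (induction k arbitrary: f g)
  case 0
  then show ?case by (metis Ck_on.simps(1) continuous_on_cong)
next
  case (Suc k)
  have "g differentiable (at x)" if "x \<in> S" for x
  proof (rule differentiable_cong[OF \<open>open S\<close> that Suc.prems(1)])
    show "f differentiable (at x)"
      using Suc.prems(2) that by (simp add: differentiable_on_eq_differentiable_at[OF \<open>open S\<close>])
  qed
  then have "g differentiable_on S"
    by (rule differentiable_at_imp_differentiable_on)
  moreover have "Ck_on k S (\<lambda>x. D g x v)" for v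
  proof (rule Suc.IH[of "\<lambda>x. D f x v"])
    show "D f x v = D g x v" if "x \<in> S" for x
      using D_cong[OF \<open>open S\<close> that Suc.prems(1)] by simp
    show "Ck_on k S (\<lambda>x. D f x v)" using Suc.prems(2) by simp
  qed
  ultimately show ?case by simp
qed

lemma Ck_on_Suc_imp: "Ck_on (Suc k) S f \<Longrightarrow> Ck_on k S f"
proof (induction k arbitrary: f)
  case 0
  then show ?case by (simp add: differentiable_imp_continuous_on)
next
  case (Suc k)
  then show ?case by (metis Ck_on.simps(2))
qed

lemma Ck_on_const: "Ck_on k S (\<lambda>_. c)"
  by (induction k arbitrary: c) auto

lemma Ck_on_add:
  assumes "open S" "Ck_on k S f" "Ck_on k S g"
  shows "Ck_on k S (\<lambda>x. f x + g x)"
  using assms(2,3)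
proof (induction k arbitrary: f g)
  case 0
  then show ?case by (simp add: continuous_on_add)
next
  case (Suc k)
  have d: "f differentiable (at x)" "g differentiable (at x)" if "x \<in> S" for x
    using Suc.prems that by (auto simp: differentiable_on_eq_differentiable_at[OF \<open>open S\<close>])
  have "Ck_on k S (\<lambda>x. D (\<lambda>x. f x + g x) x v)" for v
    by (rule Ck_on_cong[OF \<open>open S\<close>, of "\<lambda>x. D f x v + D g x v"])
      (use Suc d in \<open>auto simp: D_add\<close>)
  with Suc.prems show ?case by (simp add: differentiable_on_add)
qed

lemma Ck_on_bilinear:
  fixes B :: "'b::real_normed_vector \<Rightarrow> 'c::real_normed_vector \<Rightarrow> 'd::real_normed_vector"
  assumes "open S" "bounded_bilinear B" "Ck_on k S f" "Ck_on k S g"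
  shows "Ck_on k S (\<lambda>x. B (f x) (g x))"
  using assms(3,4)
proof (induction k arbitrary: f g)
  case 0
  then show ?case by (simp add: bounded_bilinear.continuous_on[OF assms(2)])
next
  case (Suc k)
  have d: "f differentiable (at x)" "g differentiable (at x)" if "x \<in> S" for x
    using Suc.prems that by (auto simp: differentiable_on_eq_differentiable_at[OF \<open>open S\<close>])
  have C: "Ck_on k S f" "Ck_on k S g"
    using Suc.prems by (auto intro: Ck_on_Suc_imp)
  have "Ck_on k S (\<lambda>x. D (\<lambda>x. B (f x) (g x)) x v)" for v
    by (rule Ck_on_cong[OF \<open>open S\<close>, of "\<lambda>x. B (f x) (D g x v) + B (D f x v) (g x)"])
      (use Suc C d in \<open>auto simp: D_bilinear[OF assms(2)] intro!: Ck_on_add \<open>open S\<close>\<close>)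
  moreover have "(\<lambda>x. B (f x) (g x)) differentiable_on S"
    using d by (intro differentiable_at_imp_differentiable_on differentiable_bilinear[OF assms(2)])
  ultimately show ?case by simp
qed

text \<open>The derivative of 1/f is a product of 1/f, f' and 1/f, so the induction hypothesis for
  1/f itself supplies the next order.\<close>

lemma Ck_on_inverse:
  fixes f :: "'a::euclidean_space \<Rightarrow> real"
  assumes "open S" "\<And>x. x \<in> S \<Longrightarrow> f x \<noteq> 0" "Ck_on k S f"
  shows "Ck_on k S (\<lambda>x. inverse (f x))"
  using assms(3)
proof (induction k)
  case 0
  then show ?case using assms(2) by (simp add: continuous_on_inverse)
next
  case (Suc k)
  have d: "f differentiable (at x)" if "x \<in> S" for x
    using Suc.prems that by (auto simp: differentiable_on_eq_differentiable_at[OF \<open>open S\<close>])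
  have i: "((\<lambda>x. inverse (f x)) has_derivative
      (\<lambda>v. - (inverse (f x) * D f x v * inverse (f x)))) (at x)" if "x \<in> S" for x
    using assms(2)[OF that] Deriv.has_derivative_inverse[OF _ D_works[OF d[OF that]]] by simp
  have C: "Ck_on k S (\<lambda>x. inverse (f x))"
    using Suc.IH[OF Ck_on_Suc_imp[OF Suc.prems]] .
  have "Ck_on k S (\<lambda>x. (- 1) * (inverse (f x) * (D f x v * inverse (f x))))" for v
    using C Suc.prems
    by (intro Ck_on_bilinear[OF \<open>open S\<close> bounded_bilinear_mult] Ck_on_const) auto
  then have "Ck_on k S (\<lambda>x. D (\<lambda>x. inverse (f x)) x v)" for v
    by (intro Ck_on_cong[OF \<open>open S\<close> _ \<open>Ck_on k S (\<lambda>x. (- 1) * (inverse (f x) * (D f x v * inverse (f x))))\<close>])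
      (simp add: D_eqI[OF i] mult.assoc)
  moreover have "(\<lambda>x. inverse (f x)) differentiable_on S"
    using i by (auto simp: differentiable_on_eq_differentiable_at[OF \<open>open S\<close>] differentiable_def)
  ultimately show ?case by simp
qed

lemma smooth_on_D: "smooth_on S f \<Longrightarrow> smooth_on S (\<lambda>x. D f x v)"
  unfolding smooth_on_def by (metis Ck_on.simps(2))

lemma smooth_on_differentiable:
  assumes "open S" "smooth_on S f" "x \<in> S"
  shows "f differentiable (at x)"
proof -
  have "Ck_on (Suc 0) S f" using assms by (simp only: smooth_on_def)
  then show ?thesis using assms by (simp add: differentiable_on_eq_differentiable_at)
qed

lemma smooth_on_continuous: "smooth_on S f \<Longrightarrow> continuous_on S f"
  unfolding smooth_on_def by (metis Ck_on.simps(1))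

lemma smooth_on_cong:
  assumes "open S" "\<And>x. x \<in> S \<Longrightarrow> f x = g x" "smooth_on S f"
  shows "smooth_on S g"
  using assms unfolding smooth_on_def by (blast intro: Ck_on_cong)

lemma smooth_on_const: "smooth_on S (\<lambda>_. c)"
  by (simp add: smooth_on_def Ck_on_const)

lemma smooth_on_add:
  "open S \<Longrightarrow> smooth_on S f \<Longrightarrow> smooth_on S g \<Longrightarrow> smooth_on S (\<lambda>x. f x + g x)"
  by (simp add: smooth_on_def Ck_on_add)

lemma smooth_on_mult:
  fixes f g :: "'a::euclidean_space \<Rightarrow> real"
  shows "open S \<Longrightarrow> smooth_on S f \<Longrightarrow> smooth_on S g \<Longrightarrow> smooth_on S (\<lambda>x. f x * g x)"
  by (simp add: smooth_on_def Ck_on_bilinear[OF _ bounded_bilinear_mult])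

lemma smooth_on_scaleR:
  "open S \<Longrightarrow> smooth_on S f \<Longrightarrow> smooth_on S g \<Longrightarrow> smooth_on S (\<lambda>x. f x *\<^sub>R g x)"
  by (simp add: smooth_on_def Ck_on_bilinear[OF _ bounded_bilinear_scaleR])

lemma smooth_on_inner:
  fixes f g :: "'a::euclidean_space \<Rightarrow> 'b::euclidean_space"
  shows "open S \<Longrightarrow> smooth_on S f \<Longrightarrow> smooth_on S g \<Longrightarrow> smooth_on S (\<lambda>x. f x \<bullet> g x)"
  by (simp add: smooth_on_def Ck_on_bilinear[OF _ bounded_bilinear_inner])

lemma smooth_on_minus: "open S \<Longrightarrow> smooth_on S f \<Longrightarrow> smooth_on S (\<lambda>x. - f x)"
  using smooth_on_scaleR[OF _ smooth_on_const, of S f "- 1"] by simp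

lemma smooth_on_diff:
  "open S \<Longrightarrow> smooth_on S f \<Longrightarrow> smooth_on S g \<Longrightarrow> smooth_on S (\<lambda>x. f x - g x)"
  using smooth_on_add[OF _ _ smooth_on_minus, of S f g] by simp

lemma smooth_on_divide:
  fixes f g :: "'a::euclidean_space \<Rightarrow> real"
  assumes "open S" "smooth_on S f" "smooth_on S g" "\<And>x. x \<in> S \<Longrightarrow> g x \<noteq> 0"
  shows "smooth_on S (\<lambda>x. f x / g x)"
proof -
  have "smooth_on S (\<lambda>x. inverse (g x))"
    using assms by (simp add: smooth_on_def Ck_on_inverse)
  then show ?thesis
    using smooth_on_mult[OF assms(1,2)] by (simp add: divide_inverse)
qed

lemma smooth_on_sum:
  assumes "open S" "\<And>i. i \<in> I \<Longrightarrow> smooth_on S (f i)"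
  shows "smooth_on S (\<lambda>x. \<Sum>i\<in>I. f i x)"
  using assms(2)
proof (induction I rule: infinite_finite_induct)
  case (insert i I)
  then show ?case by (simp add: smooth_on_add[OF \<open>open S\<close>])
qed (simp_all add: smooth_on_const)

lemma Ck_on_subset:
  assumes "open S" "open U" "U \<subseteq> S"
  shows "Ck_on k S f \<Longrightarrow> Ck_on k U f"
proof (induction k arbitrary: f)
  case 0
  then show ?case using assms(3) by (auto intro: continuous_on_subset)
next
  case (Suc k)
  then show ?case using assms(3) by (auto intro: differentiable_on_subset)
qed

lemma smooth_on_subset:
  "open S \<Longrightarrow> open U \<Longrightarrow> U \<subseteq> S \<Longrightarrow> smooth_on S f \<Longrightarrow> smooth_on U f"
  unfolding smooth_on_def by (blast intro: Ck_on_subset)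

lemmas smooth_intros = smooth_on_const smooth_on_add smooth_on_mult smooth_on_scaleR
  smooth_on_inner smooth_on_minus smooth_on_diff smooth_on_sum smooth_on_D

section \<open>Symmetry of second derivatives\<close>

lemma second_difference_mvt:
  fixes f :: "'a::euclidean_space \<Rightarrow> real"
  assumes f: "\<And>y. y \<in> ball x r \<Longrightarrow> f differentiable (at y)"
    and fu: "\<And>y. y \<in> ball x r \<Longrightarrow> (\<lambda>z. D f z u) differentiable (at y)"
    and h: "0 < h" "h * (norm u + norm v) < r"
  shows "\<exists>s t. 0 < s \<and> s < h \<and> 0 < t \<and> t < h \<and>
    f (x + h *\<^sub>R u + h *\<^sub>R v) - f (x + h *\<^sub>R u) - f (x + h *\<^sub>R v) + f x
      = h * (h * D (\<lambda>z. D f z u) (x + s *\<^sub>R u + t *\<^sub>R v) v)"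
proof -
  have inb: "x + s *\<^sub>R u + t *\<^sub>R v \<in> ball x r" if "0 \<le> s" "s \<le> h" "0 \<le> t" "t \<le> h" for s t
  proof -
    have "norm (s *\<^sub>R u + t *\<^sub>R v) \<le> s * norm u + t * norm v"
      using that by (metis abs_of_nonneg norm_scaleR norm_triangle_ineq)
    also have "\<dots> \<le> h * norm u + h * norm v"
      using that by (intro add_mono mult_right_mono) auto
    also have "\<dots> < r" using h by (simp add: algebra_simps)
    finally have "norm (- (s *\<^sub>R u + t *\<^sub>R v)) < r" by (simp only: norm_minus_cancel)
    then show ?thesis by (simp add: dist_norm algebra_simps)
  qed
  \<comment> \<open>The second difference is the increment of \<open>p\<close> over [0, h]. The mean
    value theorem in \<open>s\<close> produces the derivative along \<open>u\<close>, and a second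
    application in \<open>t\<close> the one along \<open>v\<close>.\<close>
  define p where "p s = f (x + s *\<^sub>R u + h *\<^sub>R v) - f (x + s *\<^sub>R u)" for s
  have line: "((\<lambda>s. f (a + s *\<^sub>R w)) has_real_derivative D f (a + s *\<^sub>R w) w) (at s)"
    if "f differentiable (at (a + s *\<^sub>R w))" for f :: "'a \<Rightarrow> real" and a w s
  proof -
    have "((\<lambda>s. f (a + s *\<^sub>R w)) has_derivative (\<lambda>q. D f (a + s *\<^sub>R w) (q *\<^sub>R w))) (at s)"
      by (rule has_derivative_compose[of "\<lambda>s. a + s *\<^sub>R w"])
        (auto intro!: derivative_eq_intros D_works that)
    then show ?thesis
      unfolding has_field_derivative_def
      by (rule has_derivative_eq_rhs)
        (simp add: fun_eq_iff linear_cmul[OF D_linear[OF that]])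
  qed
  have p': "(p has_real_derivative (D f (x + s *\<^sub>R u + h *\<^sub>R v) u - D f (x + s *\<^sub>R u) u)) (at s)"
    if "0 \<le> s" "s \<le> h" for s
  proof -
    have 1: "((\<lambda>s. f ((x + h *\<^sub>R v) + s *\<^sub>R u)) has_real_derivative
        D f ((x + h *\<^sub>R v) + s *\<^sub>R u) u) (at s)"
      by (rule line) (use f[OF inb[of s h]] h that in \<open>simp add: algebra_simps\<close>)
    have 2: "((\<lambda>s. f (x + s *\<^sub>R u)) has_real_derivative D f (x + s *\<^sub>R u) u) (at s)"
      by (rule line) (use f[OF inb[of s 0]] h that in simp)
    show ?thesis
      using DERIV_diff[OF 1 2] by (simp add: p_def[abs_def] algebra_simps)
  qed
  obtain s where s: "0 < s" "s < h"
    "p h - p 0 = (h - 0) * (D f (x + s *\<^sub>R u + h *\<^sub>R v) u - D f (x + s *\<^sub>R u) u)"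
    using MVT2[OF h(1), of p "\<lambda>s. D f (x + s *\<^sub>R u + h *\<^sub>R v) u - D f (x + s *\<^sub>R u) u"] p'
    by blast
  have q': "((\<lambda>t. D f (x + s *\<^sub>R u + t *\<^sub>R v) u) has_real_derivative
      D (\<lambda>z. D f z u) (x + s *\<^sub>R u + t *\<^sub>R v) v) (at t)" if "0 \<le> t" "t \<le> h" for t
    by (rule line[of "\<lambda>z. D f z u" "x + s *\<^sub>R u"]) (use fu[OF inb] s that in auto)
  obtain t where t: "0 < t" "t < h"
    "D f (x + s *\<^sub>R u + h *\<^sub>R v) u - D f (x + s *\<^sub>R u + 0 *\<^sub>R v) u
      = (h - 0) * D (\<lambda>z. D f z u) (x + s *\<^sub>R u + t *\<^sub>R v) v"
    using MVT2[OF h(1), of "\<lambda>t. D f (x + s *\<^sub>R u + t *\<^sub>R v) u"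
      "\<lambda>t. D (\<lambda>z. D f z u) (x + s *\<^sub>R u + t *\<^sub>R v) v"] q' by blast
  have "p h - p 0 = h * (h * D (\<lambda>z. D f z u) (x + s *\<^sub>R u + t *\<^sub>R v) v)"
    using s t by simp
  then show ?thesis
    using s t by (intro exI[of _ s] exI[of _ t]) (simp add: p_def)
qed

text \<open>The second difference is symmetric in \<open>u\<close> and \<open>v\<close>, so the two
  mixed derivatives agree at two points arbitrarily close to \<open>x\<close>. Continuity then
  excludes a gap between their values at \<open>x\<close>.\<close>

lemma D_commute_real:
  fixes f :: "'a::euclidean_space \<Rightarrow> real"
  assumes S: "open S" "smooth_on S f" "x \<in> S"
  shows "D (\<lambda>y. D f y u) x v = D (\<lambda>y. D f y v) x u"
proof (rule ccontr)
  let ?a = "\<lambda>y. D (\<lambda>y. D f y u) y v" and ?b = "\<lambda>y. D (\<lambda>y. D f y v) y u"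
  assume ne: "?a x \<noteq> ?b x"
  \<comment> \<open>With half the gap as tolerance, the two neighbourhoods of values are
    disjoint.\<close>
  define e where "e = \<bar>?a x - ?b x\<bar> / 2"
  have e: "e > 0" using ne by (simp add: e_def)
  have "continuous_on S ?a" "continuous_on S ?b"
    using S by (auto intro!: smooth_on_continuous smooth_on_D)
  then obtain d1 d2 where d: "d1 > 0" "\<And>y. y \<in> S \<Longrightarrow> dist y x < d1 \<Longrightarrow> dist (?a y) (?a x) < e"
      "d2 > 0" "\<And>y. y \<in> S \<Longrightarrow> dist y x < d2 \<Longrightarrow> dist (?b y) (?b x) < e"
    using e S(3) unfolding continuous_on_iff by (metis (no_types, lifting))
  obtain d0 where d0: "d0 > 0" "ball x d0 \<subseteq> S"
    using S by (meson open_contains_ball)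
  define r where "r = min d0 (min d1 d2)"
  have r: "r > 0" "ball x r \<subseteq> S" using d d0 by (auto simp: r_def)
  \<comment> \<open>The summand 1 keeps the denominator positive when \<open>u\<close> and
    \<open>v\<close> are both 0; the factor 2 makes the bound by \<open>r\<close> strict.\<close>
  define h where "h = r / (2 * (norm u + norm v + 1))"
  have pos: "norm u + norm v + 1 > 0" by (simp add: add_nonneg_pos)
  have h: "h > 0" using r pos by (simp add: h_def)
  have "h * (norm u + norm v) < h * (2 * (norm u + norm v + 1))"
    using h pos by (intro mult_strict_left_mono) auto
  also have "\<dots> = r" using pos by (simp add: h_def)
  finally have hr: "h * (norm u + norm v) < r" .
  have near: "dist (x + s *\<^sub>R u' + t *\<^sub>R v') x < r"
    if "0 < s" "s < h" "0 < t" "t < h" "norm u' + norm v' = norm u + norm v" for s t u' v'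
  proof -
    have "norm (s *\<^sub>R u' + t *\<^sub>R v') \<le> s * norm u' + t * norm v'"
      using that by (metis abs_of_pos norm_scaleR norm_triangle_ineq)
    also have "\<dots> \<le> h * norm u' + h * norm v'"
      using that by (intro add_mono mult_right_mono) auto
    also have "\<dots> < r" using hr that by (simp add: distrib_left[symmetric])
    finally show ?thesis by (simp add: dist_norm add.assoc)
  qed
  have df: "f differentiable (at y)" "(\<lambda>z. D f z w) differentiable (at y)" if "y \<in> ball x r" for y w
    using that r S by (auto intro!: smooth_on_differentiable[OF S(1)] smooth_on_D)
  obtain s t where 1: "0 < s" "s < h" "0 < t" "t < h"
    "f (x + h *\<^sub>R u + h *\<^sub>R v) - f (x + h *\<^sub>R u) - f (x + h *\<^sub>R v) + f x
      = h * (h * ?a (x + s *\<^sub>R u + t *\<^sub>R v))"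
    using second_difference_mvt[of x r f u h v] df h hr by blast
  obtain s' t' where 2: "0 < s'" "s' < h" "0 < t'" "t' < h"
    "f (x + h *\<^sub>R v + h *\<^sub>R u) - f (x + h *\<^sub>R v) - f (x + h *\<^sub>R u) + f x
      = h * (h * ?b (x + s' *\<^sub>R v + t' *\<^sub>R u))"
    using second_difference_mvt[of x r f v h u] df h hr by (auto simp: add.commute)
  have "?a (x + s *\<^sub>R u + t *\<^sub>R v) = ?b (x + s' *\<^sub>R v + t' *\<^sub>R u)"
    using 1 2 h by (simp add: algebra_simps)
  moreover have "dist (?a (x + s *\<^sub>R u + t *\<^sub>R v)) (?a x) < e"
    using near[of s t u v] 1 r by (intro d) (auto simp: r_def dist_commute subset_iff)
  moreover have "dist (?b (x + s' *\<^sub>R v + t' *\<^sub>R u)) (?b x) < e"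
    using near[of s' t' v u] 2 r by (intro d) (auto simp: r_def dist_commute subset_iff)
  ultimately show False
    unfolding e_def dist_real_def by (smt (verit, best) field_sum_of_halves)
qed

lemma D_commute:
  fixes f :: "'a::euclidean_space \<Rightarrow> 'b::euclidean_space"
  assumes S: "open S" "smooth_on S f" "x \<in> S"
  shows "D (\<lambda>y. D f y u) x v = D (\<lambda>y. D f y v) x u"
proof (rule euclidean_eqI)
  fix b :: 'b assume "b \<in> Basis"
  have bl: "bounded_linear (\<lambda>z::'b. z \<bullet> b)" by (rule bounded_linear_inner_left)
  have d: "f differentiable (at y)" "(\<lambda>y. D f y w) differentiable (at y)" if "y \<in> S" for y w
    using that S by (auto intro!: smooth_on_differentiable[OF S(1)] smooth_on_D)
  have "D (\<lambda>y. D f y u) x v \<bullet> b = D (\<lambda>y. D (\<lambda>z. f z \<bullet> b) y u) x v" for u v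
  proof -
    have "D (\<lambda>y. D f y u) x v \<bullet> b = D (\<lambda>y. D f y u \<bullet> b) x v"
      by (rule D_bounded_linear[OF bl d(2)[OF S(3)], symmetric])
    also have "\<dots> = D (\<lambda>y. D (\<lambda>z. f z \<bullet> b) y u) x v"
      by (rule fun_cong[OF D_cong[OF S(1,3)]]) (rule D_bounded_linear[OF bl d(1), symmetric])
    finally show ?thesis .
  qed
  then show "D (\<lambda>y. D f y u) x v \<bullet> b = D (\<lambda>y. D f y v) x u \<bullet> b"
    using D_commute_real[OF S(1) smooth_on_inner[OF S(1,2) smooth_on_const] S(3), of b u v] by simp
qed

subsection \<open>Smooth fields of linear and bilinear maps\<close>

text \<open>Smoothness is asked for fixed arguments only, as in \<open>tensor2_field\<close>;
  expansion in the standard basis extends it to arguments that move with the point.\<close>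

definition linear_field :: "'e::euclidean_space set \<Rightarrow> ('e \<Rightarrow> 'c::euclidean_space \<Rightarrow> 'b::euclidean_space) \<Rightarrow> bool" where
  "linear_field S a \<longleftrightarrow> (\<forall>x\<in>S. linear (a x)) \<and> (\<forall>v. smooth_on S (\<lambda>x. a x v))"

definition bilinear_field ::
    "'e::euclidean_space set \<Rightarrow> ('e \<Rightarrow> 'c::euclidean_space \<Rightarrow> 'c \<Rightarrow> 'b::euclidean_space) \<Rightarrow> bool" where
  "bilinear_field S b \<longleftrightarrow> (\<forall>x\<in>S. bilinear (b x)) \<and> (\<forall>u v. smooth_on S (\<lambda>x. b x u v))"

lemma linear_basis_expand:
  fixes a :: "'c::euclidean_space \<Rightarrow> 'b::real_vector"
  assumes "linear a"
  shows "a v = (\<Sum>i\<in>Basis. (v \<bullet> i) *\<^sub>R a i)"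
proof -
  have "a v = a (\<Sum>i\<in>Basis. (v \<bullet> i) *\<^sub>R i)" by (simp add: euclidean_representation)
  then show ?thesis by (simp add: linear_sum[OF assms] linear_cmul[OF assms])
qed

lemma bilinear_field_lin:
  assumes "bilinear_field S b"
  shows "linear_field S (\<lambda>x v. b x v w)" "linear_field S (\<lambda>x w. b x v w)"
  using assms by (auto simp: bilinear_field_def linear_field_def bilinear_def)

lemma Ck_on_compose:
  fixes f :: "'a::euclidean_space \<Rightarrow> 'b::euclidean_space" and t :: "'c::euclidean_space \<Rightarrow> 'a"
  assumes U: "open U" and S: "open S" and t: "smooth_on U t" "t ` U \<subseteq> S"
  shows "Ck_on k S f \<Longrightarrow> Ck_on k U (\<lambda>x. f (t x))"
proof (induction k arbitrary: f)
  case 0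
  then show ?case
    using continuous_on_compose2[OF _ smooth_on_continuous[OF t(1)] t(2)] by simp
next
  case (Suc k)
  have d: "f differentiable (at (t x))" if "x \<in> U" for x
    using Suc.prems t(2) that by (auto simp: differentiable_on_eq_differentiable_at[OF S])
  have dt: "t differentiable (at x)" if "x \<in> U" for x
    by (rule smooth_on_differentiable[OF U t(1) that])
  have chain: "((\<lambda>x. f (t x)) has_derivative (\<lambda>v. D f (t x) (D t x v))) (at x)" if "x \<in> U" for x
    using has_derivative_compose[OF D_works[OF dt[OF that]] D_works[OF d[OF that]]] .
  \<comment> \<open>The chain rule differentiates \<open>f\<close> in the moving direction
    \<open>D t x v\<close>, whereas \<open>Ck_on\<close> speaks of fixed directions. Expanding in
    the basis reduces the one to the other.\<close>
  have sum: "Ck_on k U (\<lambda>x. \<Sum>j\<in>J. (D t x v \<bullet> j) *\<^sub>R D f (t x) j)" if "finite J" for J v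
    using that
  proof (induction J rule: finite_induct)
    case (insert j J)
    have "Ck_on k U (\<lambda>x. D f (t x) j)"
      using Suc.prems by (intro Suc.IH[of "\<lambda>y. D f y j"]) simp
    moreover have "Ck_on k U (\<lambda>x. D t x v \<bullet> j)"
      using smooth_on_inner[OF U smooth_on_D[OF t(1)] smooth_on_const] by (simp add: smooth_on_def)
    ultimately have "Ck_on k U (\<lambda>x. (D t x v \<bullet> j) *\<^sub>R D f (t x) j)"
      by (intro Ck_on_bilinear[OF U bounded_bilinear_scaleR])
    with insert show ?case by (simp add: Ck_on_add[OF U])
  qed (simp add: Ck_on_const)
  have "(\<lambda>x. f (t x)) differentiable_on U"
    using chain by (auto simp: differentiable_on_eq_differentiable_at[OF U] differentiable_def)
  moreover have "Ck_on k U (\<lambda>x. D (\<lambda>x. f (t x)) x v)" for v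
    by (rule Ck_on_cong[OF U _ sum[OF finite_Basis]])
      (simp add: D_eqI[OF chain] linear_basis_expand[OF D_linear[OF d], symmetric])
  ultimately show ?case by simp
qed

lemma smooth_on_compose:
  fixes f :: "'a::euclidean_space \<Rightarrow> 'b::euclidean_space" and t :: "'c::euclidean_space \<Rightarrow> 'a"
  assumes "open U" "open S" "smooth_on U t" "t ` U \<subseteq> S" "smooth_on S f"
  shows "smooth_on U (\<lambda>x. f (t x))"
  using assms(5) Ck_on_compose[OF assms(1-4)] unfolding smooth_on_def by blast

lemma linear_field_smooth:
  assumes S: "open S" and a: "linear_field S a" and V: "smooth_on S V"
  shows "smooth_on S (\<lambda>y. a y (V y))"
proof (rule smooth_on_cong[OF S])
  show "(\<Sum>i\<in>Basis. (V y \<bullet> i) *\<^sub>R a y i) = a y (V y)" if "y \<in> S" for y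
    using a that by (simp add: linear_field_def linear_basis_expand[of "a y" "V y"])
  show "smooth_on S (\<lambda>y. \<Sum>i\<in>Basis. (V y \<bullet> i) *\<^sub>R a y i)"
    using a V by (intro smooth_intros S) (auto simp: linear_field_def)
qed

text \<open>The Leibniz rule for a field of maps applied to a moving vector. It separates the
  derivative of the map, with the vector frozen at \<open>x\<close>, from the derivative of the
  vector.\<close>

lemma D_linear_field:
  assumes S: "open S" and a: "linear_field S a" and V: "smooth_on S V" and x: "x \<in> S"
  shows "D (\<lambda>y. a y (V y)) x u = D (\<lambda>y. a y (V x)) x u + a x (D V x u)"
proof -
  have e: "a y w = (\<Sum>i\<in>Basis. (w \<bullet> i) *\<^sub>R a y i)" if "y \<in> S" for y w
    using a that by (simp add: linear_field_def linear_basis_expand[of "a y" w])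
  have da: "(\<lambda>y. a y i) differentiable (at x)" for i
    using a x by (auto simp: linear_field_def intro: smooth_on_differentiable[OF S])
  have dV: "V differentiable (at x)" by (rule smooth_on_differentiable[OF S V x])
  have dVi: "(\<lambda>y. V y \<bullet> i) differentiable (at x)" for i
    by (intro differentiable_bilinear[OF bounded_bilinear_inner] dV differentiable_const)
  have "D (\<lambda>y. a y (V y)) x u = D (\<lambda>y. \<Sum>i\<in>Basis. (V y \<bullet> i) *\<^sub>R a y i) x u"
    by (rule fun_cong[OF D_cong[OF S x]]) (rule e)
  also have "\<dots> = (\<Sum>i\<in>Basis. (V x \<bullet> i) *\<^sub>R D (\<lambda>y. a y i) x u) + (\<Sum>i\<in>Basis. (D V x u \<bullet> i) *\<^sub>R a x i)"
    using da dVi dV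
    by (simp add: D_sum differentiable_bilinear[OF bounded_bilinear_scaleR] D_scaleR
        D_bounded_linear[OF bounded_linear_inner_left] sum.distrib)
  also have "(\<Sum>i\<in>Basis. (D V x u \<bullet> i) *\<^sub>R a x i) = a x (D V x u)"
    by (rule e[OF x, symmetric])
  also have "(\<Sum>i\<in>Basis. (V x \<bullet> i) *\<^sub>R D (\<lambda>y. a y i) x u) = D (\<lambda>y. \<Sum>i\<in>Basis. (V x \<bullet> i) *\<^sub>R a y i) x u"
    using da by (simp add: D_sum differentiable_bilinear[OF bounded_bilinear_scaleR] D_scaleR)
  also have "\<dots> = D (\<lambda>y. a y (V x)) x u"
    by (rule fun_cong[OF D_cong[OF S x]]) (rule e[symmetric])
  finally show ?thesis .
qed

lemma linear_field_D:
  assumes S: "open S" and f: "smooth_on S f"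
  shows "linear_field S (\<lambda>x v. D f x v)"
  using assms by (auto simp: linear_field_def intro!: D_linear smooth_on_D smooth_on_differentiable)

lemma linear_field_D_arg:
  assumes S: "open S" and a: "linear_field S a"
  shows "linear_field S (\<lambda>x v. D (\<lambda>y. a y v) x u)"
proof -
  have d: "(\<lambda>y. a y v) differentiable (at x)" if "x \<in> S" for x v
    using a that by (auto simp: linear_field_def intro: smooth_on_differentiable[OF S])
  have "linear (\<lambda>v. D (\<lambda>y. a y v) x u)" if x: "x \<in> S" for x
  proof (rule linearI)
    fix v w c
    have "D (\<lambda>y. a y (v + w)) x u = D (\<lambda>y. a y v + a y w) x u"
      using a by (intro fun_cong[OF D_cong[OF S x]]) (simp add: linear_field_def linear_add)
    then show "D (\<lambda>y. a y (v + w)) x u = D (\<lambda>y. a y v) x u + D (\<lambda>y. a y w) x u"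
      by (simp add: D_add d x)
    have "D (\<lambda>y. a y (c *\<^sub>R v)) x u = D (\<lambda>y. c *\<^sub>R a y v) x u"
      using a by (intro fun_cong[OF D_cong[OF S x]]) (simp add: linear_field_def linear_cmul)
    then show "D (\<lambda>y. a y (c *\<^sub>R v)) x u = c *\<^sub>R D (\<lambda>y. a y v) x u"
      by (simp add: D_bounded_linear[OF bounded_linear_scaleR_right] d x)
  qed
  then show ?thesis using a by (auto simp: linear_field_def intro: smooth_on_D)
qed

lemma bilinear_field_D:
  assumes S: "open S" and b: "bilinear_field S b"
  shows "bilinear_field S (\<lambda>x v w. D (\<lambda>y. b y v w) x u)"
  using linear_field_D_arg[OF S bilinear_field_lin(1)[OF b]]
    linear_field_D_arg[OF S bilinear_field_lin(2)[OF b]]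
  by (auto simp: linear_field_def bilinear_field_def bilinear_def)

lemma bilinear_field_smooth:
  assumes S: "open S" and b: "bilinear_field S b" and V: "smooth_on S V" "smooth_on S W"
  shows "smooth_on S (\<lambda>y. b y (V y) (W y))"
proof -
  have "linear_field S (\<lambda>y v. b y v (W y))"
    using b linear_field_smooth[OF S bilinear_field_lin(2)[OF b] V(2)]
    by (auto simp: linear_field_def bilinear_field_def bilinear_def)
  from linear_field_smooth[OF S this V(1)] show ?thesis .
qed

lemma D_bilinear_field:
  assumes S: "open S" and b: "bilinear_field S b" and V: "smooth_on S V" "smooth_on S W" and x: "x \<in> S"
  shows "D (\<lambda>y. b y (V y) (W y)) x u =
    D (\<lambda>y. b y (V x) (W x)) x u + b x (D V x u) (W x) + b x (V x) (D W x u)"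
proof -
  have "linear_field S (\<lambda>y v. b y v (W y))"
    using b linear_field_smooth[OF S bilinear_field_lin(2)[OF b] V(2)]
    by (auto simp: linear_field_def bilinear_field_def bilinear_def)
  from D_linear_field[OF S this V(1) x]
  have "D (\<lambda>y. b y (V y) (W y)) x u = D (\<lambda>y. b y (V x) (W y)) x u + b x (D V x u) (W x)" .
  also have "D (\<lambda>y. b y (V x) (W y)) x u = D (\<lambda>y. b y (V x) (W x)) x u + b x (V x) (D W x u)"
    by (rule D_linear_field[OF S bilinear_field_lin(2)[OF b] V(2) x])
  finally show ?thesis by simp
qed

lemma bilinear_field_cong:
  assumes "open S" "bilinear_field S b" "\<And>x u v. x \<in> S \<Longrightarrow> b x u v = b' x u v"
  shows "bilinear_field S b'"
proof -
  have "b x = b' x" if "x \<in> S" for x using assms(3)[OF that] by blast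
  moreover have "smooth_on S (\<lambda>x. b' x u v)" for u v
    using assms(2) by (intro smooth_on_cong[OF assms(1) assms(3)]) (simp_all add: bilinear_field_def)
  ultimately show ?thesis using assms(2) by (simp add: bilinear_field_def)
qed

lemma bilinear_field_add:
  assumes "open S" "bilinear_field S a" "bilinear_field S b"
  shows "bilinear_field S (\<lambda>x u v. a x u v + b x u v)"
  using assms
  by (auto simp: bilinear_field_def bilinear_def intro!: linear_compose_add smooth_on_add)

lemma bilinear_field_diff:
  assumes "open S" "bilinear_field S a" "bilinear_field S b"
  shows "bilinear_field S (\<lambda>x u v. a x u v - b x u v)"
  using assms
  by (auto simp: bilinear_field_def bilinear_def intro!: linear_compose_sub smooth_on_diff)

lemma bilinear_field_left:
  assumes "open S" "bilinear_field S b" "linear_field S L"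
  shows "bilinear_field S (\<lambda>x u v. b x (L x u) v)"
proof -
  have "linear (\<lambda>u. b x (L x u) v)" if "x \<in> S" for x v
    using linear_compose[of "L x" "\<lambda>u. b x u v"] assms that
    by (auto simp: bilinear_field_def linear_field_def bilinear_def comp_def)
  moreover have "linear (\<lambda>v. b x (L x u) v)" if "x \<in> S" for x u
    using assms that by (simp add: bilinear_field_def bilinear_def)
  moreover have "smooth_on S (\<lambda>x. b x (L x u) v)" for u v
    using assms(3)
    by (intro bilinear_field_smooth[OF assms(1,2)] smooth_on_const) (simp add: linear_field_def)
  ultimately show ?thesis by (simp add: bilinear_field_def bilinear_def)
qed

lemma bilinear_field_right:
  assumes "open S" "bilinear_field S b" "linear_field S L"
  shows "bilinear_field S (\<lambda>x u v. b x u (L x v))"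
proof -
  have "linear (\<lambda>v. b x u (L x v))" if "x \<in> S" for x u
    using linear_compose[of "L x" "\<lambda>v. b x u v"] assms that
    by (auto simp: bilinear_field_def linear_field_def bilinear_def comp_def)
  moreover have "linear (\<lambda>u. b x u (L x v))" if "x \<in> S" for x v
    using assms that by (simp add: bilinear_field_def bilinear_def)
  moreover have "smooth_on S (\<lambda>x. b x u (L x v))" for u v
    using assms(3)
    by (intro bilinear_field_smooth[OF assms(1,2)] smooth_on_const) (simp add: linear_field_def)
  ultimately show ?thesis by (simp add: bilinear_field_def bilinear_def)
qed

lemma bilinear_field_D_field:
  assumes S: "open S" and b: "bilinear_field S b" and K: "smooth_on S K"
  shows "bilinear_field S (\<lambda>x u v. D (\<lambda>y. b y u v) x (K x))"
proof -
  have "bilinear (\<lambda>u v. D (\<lambda>y. b y u v) x (K x))" if "x \<in> S" for x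
    using bilinear_field_D[OF S b] that by (auto simp: bilinear_field_def)
  moreover have "smooth_on S (\<lambda>x. D (\<lambda>y. b y u v) x (K x))" for u v
    using b by (intro linear_field_smooth[OF S linear_field_D[OF S] K]) (simp add: bilinear_field_def)
  ultimately show ?thesis by (simp add: bilinear_field_def)
qed

lemma bilinear_lsum: "bilinear h \<Longrightarrow> h (\<Sum>i\<in>I. f i) v = (\<Sum>i\<in>I. h (f i) v)"
  unfolding bilinear_def using linear_sum[of "\<lambda>u. h u v" f I] by simp

lemma bilinear_rsum: "bilinear h \<Longrightarrow> h v (\<Sum>i\<in>I. f i) = (\<Sum>i\<in>I. h v (f i))"
  unfolding bilinear_def using linear_sum[of "\<lambda>u. h v u" f I] by simp

lemmas bilinear_simps = bilinear_ladd bilinear_radd bilinear_lmul bilinear_rmul bilinear_lneg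
  bilinear_rneg bilinear_lzero bilinear_rzero bilinear_lsub bilinear_rsub bilinear_lsum bilinear_rsum

subsection \<open>Inner products and orthonormal bases\<close>

locale inner_form =
  fixes g :: "'e::euclidean_space \<Rightarrow> 'e \<Rightarrow> real"
  assumes bil: "bilinear g"
    and sym: "g u v = g v u"
    and pos: "u \<noteq> 0 \<Longrightarrow> 0 < g u u"
begin

lemmas g_simps = bilinear_simps[OF bil]

lemma nondegenerate:
  assumes "\<And>v. g u v = g w v"
  shows "u = w"
proof (rule ccontr)
  assume "u \<noteq> w"
  then have "0 < g (u - w) (u - w)" by (intro pos) simp
  then show False using assms[of "u - w"] by (simp add: g_simps)
qed

definition onb :: "'e set \<Rightarrow> bool" where
  "onb E \<longleftrightarrow> finite E \<and> card E = DIM('e) \<and> (\<forall>e\<in>E. \<forall>f\<in>E. g e f = (if e = f then 1 else 0))"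

lemma onb_sum:
  assumes "onb E" "e \<in> E"
  shows "g (\<Sum>f\<in>E. c f *\<^sub>R f) e = c e"
proof -
  have "g (\<Sum>f\<in>E. c f *\<^sub>R f) e = (\<Sum>f\<in>E. if f = e then c f else 0)"
    using assms unfolding g_simps by (intro sum.cong) (auto simp: onb_def)
  then show ?thesis using assms by (simp add: onb_def)
qed

text \<open>Orthonormality makes \<open>E\<close> independent, and its cardinality then makes it
  spanning; pairing with \<open>e\<close> reads off the coefficients.\<close>

lemma onb_expand:
  assumes E: "onb E"
  shows "v = (\<Sum>e\<in>E. g v e *\<^sub>R e)"
proof -
  have fin: "finite E" using E by (simp add: onb_def)
  have "independent E"
  proof (rule independent_if_scalars_zero[OF fin])
    fix c e assume "(\<Sum>f\<in>E. c f *\<^sub>R f) = 0" "e \<in> E"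
    then show "c e = 0" using onb_sum[OF E, of e c] by (simp add: g_simps)
  qed
  then have "UNIV \<subseteq> span E"
    using E by (intro card_ge_dim_independent) (auto simp: onb_def)
  then obtain c where c: "v = (\<Sum>e\<in>E. c e *\<^sub>R e)"
    using span_finite[OF fin] by blast
  then have "g v e = c e" if "e \<in> E" for e using onb_sum[OF E that] by simp
  then show ?thesis by (subst c) (auto intro: sum.cong)
qed

lemma onb_inner:
  assumes E: "onb E"
  shows "(\<Sum>e\<in>E. g u e * g e v) = g u v"
proof -
  have "g u v = g (\<Sum>e\<in>E. g u e *\<^sub>R e) v" using onb_expand[OF E, of u] by simp
  then show ?thesis by (simp add: g_simps)
qed

lemma onb_card: "onb E \<Longrightarrow> (\<Sum>e\<in>E. g e e) = real DIM('e)"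
  by (simp add: onb_def)

text \<open>Links the trace in \<open>ricci\<close>, taken in the standard basis, to contractions
  over a frame orthonormal for the metric.\<close>

lemma trace_onb:
  assumes E: "onb E" and F: "linear F"
  shows "(\<Sum>b\<in>Basis. F b \<bullet> b) = (\<Sum>e\<in>E. g (F e) e)"
proof -
  have "(\<Sum>b\<in>Basis. F b \<bullet> b) = (\<Sum>b\<in>Basis. F (\<Sum>e\<in>E. g b e *\<^sub>R e) \<bullet> b)"
    using onb_expand[OF E] by simp
  also have "\<dots> = (\<Sum>e\<in>E. \<Sum>b\<in>Basis. g b e * (F e \<bullet> b))"
    by (subst sum.swap) (simp add: linear_sum[OF F] linear_cmul[OF F] inner_sum_left)
  also have "\<dots> = (\<Sum>e\<in>E. g (\<Sum>b\<in>Basis. (F e \<bullet> b) *\<^sub>R b) e)"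
    by (simp only: g_simps real_scaleR_def mult.commute)
  also have "\<dots> = (\<Sum>e\<in>E. g (F e) e)" by (simp add: euclidean_representation)
  finally show ?thesis .
qed

text \<open>The sum pairs an antisymmetric with a symmetric matrix.\<close>

lemma sum_selfadjoint_alternating:
  assumes E: "onb E" and w: "bilinear w" "\<And>u v. w u v = - w v u"
    and F: "\<And>u v. g (F u) v = g u (F v)"
  shows "(\<Sum>e\<in>E. w e (F e) :: real) = 0"
proof -
  have "(\<Sum>e\<in>E. w e (F e)) = (\<Sum>e\<in>E. w e (\<Sum>f\<in>E. g (F e) f *\<^sub>R f))"
    using onb_expand[OF E] by simp
  also have "\<dots> = (\<Sum>e\<in>E. \<Sum>f\<in>E. g (F e) f * w e f)"
    by (simp add: bilinear_simps[OF w(1)])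
  finally have 1: "(\<Sum>e\<in>E. w e (F e)) = (\<Sum>e\<in>E. \<Sum>f\<in>E. g (F e) f * w e f)" .
  also have "\<dots> = (\<Sum>f\<in>E. \<Sum>e\<in>E. g (F e) f * w e f)" by (rule sum.swap)
  also have "\<dots> = (\<Sum>f\<in>E. \<Sum>e\<in>E. - (g (F f) e * w f e))"
  proof (intro sum.cong refl)
    fix e f
    show "g (F e) f * w e f = - (g (F f) e * w f e)"
      using F[of e f] sym[of e "F f"] w(2)[of e f] by simp
  qed
  also have "\<dots> = - (\<Sum>e\<in>E. w e (F e))" by (simp add: 1 sum_negf)
  finally show ?thesis by simp
qed

lemma onb_two:
  assumes "onb E" "DIM('e) = 2"
  obtains e f where "E = {e, f}" "e \<noteq> f" "g e e = 1" "g f f = 1" "g e f = 0" "g f e = 0"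
    "\<And>u. u = g u e *\<^sub>R e + g u f *\<^sub>R f"
proof -
  obtain e f where ef: "E = {e, f}" "e \<noteq> f"
    using assms by (auto simp: onb_def card_2_iff)
  then have "u = g u e *\<^sub>R e + g u f *\<^sub>R f" for u
    using onb_expand[OF assms(1), of u] by simp
  with ef show ?thesis using assms(1) that by (auto simp: onb_def)
qed

end

subsection \<open>The Levi-Civita connection of a metric on a coordinate domain\<close>

locale metric_field =
  fixes S :: "'e::euclidean_space set" and G :: "'e local_tensor2"
  assumes S: "open S"
    and G_field: "bilinear_field S G"
    and G_sym: "x \<in> S \<Longrightarrow> G x u v = G x v u"
    and G_pos: "x \<in> S \<Longrightarrow> u \<noteq> 0 \<Longrightarrow> 0 < G x u u"
begin

lemma inner_form: "x \<in> S \<Longrightarrow> inner_form (G x)"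
  using G_field G_sym G_pos by unfold_locales (auto simp: bilinear_field_def)

lemma G_bil: "x \<in> S \<Longrightarrow> bilinear (G x)"
  using G_field by (simp add: bilinear_field_def)

text \<open>Gram-Schmidt without normalisation.\<close>

lemma orthogonal_frame:
  assumes "finite B" "independent B"
  shows "\<exists>W. (\<forall>b\<in>B. smooth_on S (W b)) \<and> (\<forall>x\<in>S. \<forall>b\<in>B. W b x \<in> span B \<and> W b x \<noteq> 0 \<and>
    (\<forall>c\<in>B. c \<noteq> b \<longrightarrow> G x (W b x) (W c x) = 0))"
  using assms
proof (induction B rule: finite_induct)
  case empty
  then show ?case by simp
next
  case (insert c B)
  then have c: "c \<notin> span B" and B: "independent B"
    by (auto simp: independent_insert)
  obtain W where sm: "\<And>b. b \<in> B \<Longrightarrow> smooth_on S (W b)"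
    and W: "\<And>x b. x \<in> S \<Longrightarrow> b \<in> B \<Longrightarrow> W b x \<in> span B \<and> W b x \<noteq> 0 \<and>
      (\<forall>c\<in>B. c \<noteq> b \<longrightarrow> G x (W b x) (W c x) = 0)"
    using insert.IH[OF B] by metis
  define w where "w x = c - (\<Sum>b\<in>B. (G x c (W b x) / G x (W b x) (W b x)) *\<^sub>R W b x)" for x
  have smw: "smooth_on S w"
    unfolding w_def
    using sm W G_pos
    by (intro smooth_intros smooth_on_divide bilinear_field_smooth[OF S G_field] S) fastforce+
  have w: "w x \<in> span (insert c B) \<and> w x \<noteq> 0 \<and> (\<forall>b\<in>B. G x (w x) (W b x) = 0)" if x: "x \<in> S" for x
  proof -
    let ?s = "\<Sum>b\<in>B. (G x c (W b x) / G x (W b x) (W b x)) *\<^sub>R W b x"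
    have s: "?s \<in> span B" using W[OF x] by (intro span_sum span_scale) auto
    then have "w x \<in> span (insert c B)"
      unfolding w_def by (meson span_base span_diff insertI1 span_mono subset_insertI subsetD)
    \<comment> \<open>The induction keeps each orthogonalised vector in the span of the old basis,
      so the correction cannot cancel \<open>c\<close>.\<close>
    moreover have "w x \<noteq> 0" using s c by (auto simp: w_def)
    moreover have "G x (w x) (W b x) = 0" if b: "b \<in> B" for b
    proof -
      have "G x ?s (W b x) = (\<Sum>d\<in>B. (G x c (W d x) / G x (W d x) (W d x)) * G x (W d x) (W b x))"
        by (simp add: bilinear_simps[OF G_bil[OF x]])
      also have "\<dots> = (\<Sum>d\<in>B. if d = b then G x c (W b x) else 0)"
        using W[OF x] b G_pos[OF x] by (intro sum.cong) (auto, metis less_irrefl)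
      also have "\<dots> = G x c (W b x)" using b insert.hyps by simp
      finally show ?thesis by (simp add: w_def bilinear_simps[OF G_bil[OF x]])
    qed
    ultimately show ?thesis by blast
  qed
  have sp: "v \<in> span (insert c B)" if "v \<in> span B" for v
    using that by (meson span_mono subset_insertI subsetD)
  show ?case
    by (rule exI[of _ "W(c := w)"])
      (use insert.hyps sm smw w W sp G_sym in \<open>auto split: if_splits\<close>)
qed

definition frame :: "'e \<Rightarrow> 'e \<Rightarrow> 'e" where
  "frame = (SOME W. (\<forall>b\<in>Basis. smooth_on S (W b)) \<and>
    (\<forall>x\<in>S. \<forall>b\<in>Basis. W b x \<noteq> 0 \<and> (\<forall>c\<in>Basis. c \<noteq> b \<longrightarrow> G x (W b x) (W c x) = 0)))"

lemma frame:
  "b \<in> Basis \<Longrightarrow> smooth_on S (frame b)"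
  "x \<in> S \<Longrightarrow> b \<in> Basis \<Longrightarrow> frame b x \<noteq> 0"
  "x \<in> S \<Longrightarrow> b \<in> Basis \<Longrightarrow> c \<in> Basis \<Longrightarrow> c \<noteq> b \<Longrightarrow> G x (frame b x) (frame c x) = 0"
proof -
  obtain W :: "'e \<Rightarrow> 'e \<Rightarrow> 'e" where "(\<forall>b\<in>Basis. smooth_on S (W b)) \<and> (\<forall>x\<in>S. \<forall>b\<in>Basis. W b x \<in> span Basis \<and> W b x \<noteq> 0 \<and>
    (\<forall>c\<in>Basis. c \<noteq> b \<longrightarrow> G x (W b x) (W c x) = 0))"
    using orthogonal_frame[OF finite_Basis independent_Basis] ..
  then have "\<exists>W :: 'e \<Rightarrow> 'e \<Rightarrow> 'e. (\<forall>b\<in>Basis. smooth_on S (W b)) \<and>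
    (\<forall>x\<in>S. \<forall>b\<in>Basis. W b x \<noteq> 0 \<and> (\<forall>c\<in>Basis. c \<noteq> b \<longrightarrow> G x (W b x) (W c x) = 0))"
    by (intro exI[of _ W]) simp
  from someI_ex[OF this, folded frame_def]
  show "b \<in> Basis \<Longrightarrow> smooth_on S (frame b)"
    "x \<in> S \<Longrightarrow> b \<in> Basis \<Longrightarrow> frame b x \<noteq> 0"
    "x \<in> S \<Longrightarrow> b \<in> Basis \<Longrightarrow> c \<in> Basis \<Longrightarrow> c \<noteq> b \<Longrightarrow> G x (frame b x) (frame c x) = 0"
    by auto
qed

text \<open>Serves arguments at a single point. Smooth fields are built from \<open>frame\<close>,
  which involves no square roots.\<close>

definition unit_frame :: "'e \<Rightarrow> 'e \<Rightarrow> 'e" where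
  "unit_frame x b = (1 / sqrt (G x (frame b x) (frame b x))) *\<^sub>R frame b x"

lemma unit_frame:
  assumes x: "x \<in> S" "b \<in> Basis" "c \<in> Basis"
  shows "G x (unit_frame x b) (unit_frame x c) = (if b = c then 1 else 0)"
proof -
  have "G x (frame b x) (frame b x) > 0" using G_pos frame x by blast
  then show ?thesis
    using frame(3)[OF x(1), of b c] x
    by (auto simp: unit_frame_def bilinear_simps[OF G_bil[OF x(1)]] real_sqrt_mult[symmetric])
qed

lemma unit_frame_inj: "x \<in> S \<Longrightarrow> inj_on (unit_frame x) Basis"
  by (rule inj_onI) (metis unit_frame zero_neq_one)

lemma unit_frame_onb: "x \<in> S \<Longrightarrow> inner_form.onb (G x) (unit_frame x ` Basis)"
  unfolding inner_form.onb_def[OF inner_form]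
  using unit_frame inj_on_eq_iff[OF unit_frame_inj]
  by (auto simp: card_image[OF unit_frame_inj])

text \<open>The dual vector is the sum of a(e) e over an orthonormal basis. Each summand can be
  written with the unnormalised frame vector by dividing by its squared length, and in that form it
  is visibly smooth.\<close>

lemma riesz:
  assumes a: "linear_field S a"
  obtains V where "smooth_on S V" "\<And>x v. x \<in> S \<Longrightarrow> G x (V x) v = a x v"
proof
  let ?V = "\<lambda>x. \<Sum>b\<in>Basis. (a x (frame b x) / G x (frame b x) (frame b x)) *\<^sub>R frame b x"
  show "smooth_on S ?V"
    using frame G_pos
    by (intro smooth_intros smooth_on_divide bilinear_field_smooth[OF S G_field]
        linear_field_smooth[OF S a] S) fastforce+
  fix x v assume x: "x \<in> S"
  interpret inner_form "G x" by (rule inner_form[OF x])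
  have l: "linear (a x)" using a x by (simp add: linear_field_def)
  have "?V x = (\<Sum>b\<in>Basis. a x (unit_frame x b) *\<^sub>R unit_frame x b)"
  proof (intro sum.cong refl)
    fix b :: 'e assume "b \<in> Basis"
    then have "0 < G x (frame b x) (frame b x)" using frame pos x by blast
    then show "(a x (frame b x) / G x (frame b x) (frame b x)) *\<^sub>R frame b x =
        a x (unit_frame x b) *\<^sub>R unit_frame x b"
      by (simp add: unit_frame_def linear_cmul[OF l])
  qed
  also have "\<dots> = (\<Sum>e\<in>unit_frame x ` Basis. a x e *\<^sub>R e)"
    by (simp add: sum.reindex[OF unit_frame_inj[OF x]])
  finally have V: "?V x = (\<Sum>e\<in>unit_frame x ` Basis. a x e *\<^sub>R e)" .
  have "a x v = a x (\<Sum>e\<in>unit_frame x ` Basis. G x v e *\<^sub>R e)"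
    using onb_expand[OF unit_frame_onb[OF x], of v] by simp
  then show "G x (?V x) v = a x v"
    unfolding V by (simp add: g_simps linear_sum[OF l] linear_cmul[OF l] mult.commute sym)
qed

text \<open>The Koszul formula for the metric pairing of the covariant derivative with
  \<open>w\<close>; its bracket terms vanish because constant fields commute.\<close>

definition koszul :: "'e \<Rightarrow> 'e \<Rightarrow> 'e \<Rightarrow> 'e \<Rightarrow> real" where
  "koszul x u v w = (D (\<lambda>y. G y v w) x u + D (\<lambda>y. G y u w) x v - D (\<lambda>y. G y u v) x w) / 2"

abbreviation \<Gamma> :: "'e \<Rightarrow> 'e \<Rightarrow> 'e \<Rightarrow> 'e" where
  "\<Gamma> \<equiv> christoffel G"

lemma D_G_sym: "x \<in> S \<Longrightarrow> D (\<lambda>y. G y u v) x w = D (\<lambda>y. G y v u) x w"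
  by (rule fun_cong[OF D_cong[OF S]]) (auto intro: G_sym)

lemma koszul_unique:
  assumes x: "x \<in> S" and sy: "\<And>u v. C u v = C v u"
    and c: "\<And>u v w. D (\<lambda>y. G y v w) x u = G x (C u v) w + G x v (C u w)"
  shows "G x (C u v) w = koszul x u v w"
  unfolding koszul_def c using sy[of v u] sy[of w u] sy[of w v] G_sym[OF x, of "C u v" w]
    G_sym[OF x, of "C u w" v] G_sym[OF x, of "C v w" u]
  by (simp)

text \<open>Resolves the definite description: by \<open>koszul_unique\<close> any competitor has
  the same metric pairings as \<open>C\<close>. It serves both the existence proof and the
  transformation law between charts.\<close>

lemma christoffel_eqI:
  assumes x: "x \<in> S" and C: "bilinear C" "\<And>u v. C u v = C v u"
    "\<And>u v w. D (\<lambda>y. G y v w) x u = G x (C u v) w + G x v (C u w)"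
  shows "\<Gamma> x = C"
  unfolding christoffel_def
proof (rule the_equality)
  fix C' assume C': "bilinear C' \<and> (\<forall>u v. C' u v = C' v u) \<and>
     (\<forall>u v w. D (\<lambda>y. G y v w) x u = G x (C' u v) w + G x v (C' u w))"
  then have "C' u v = C u v" for u v
    using koszul_unique[OF x C(2,3)] koszul_unique[OF x, of C']
    by (intro inner_form.nondegenerate[OF inner_form[OF x]]) auto
  then show "C' = C" by blast
qed (use C in auto)

lemma koszul_field: "linear_field S (\<lambda>x w. koszul x u v w)"
  "x \<in> S \<Longrightarrow> bilinear (\<lambda>u v. koszul x u v w)"
proof -
  have l: "linear (\<lambda>w. D (\<lambda>y. G y u v) x w)" "linear (\<lambda>w. D (\<lambda>y. G y w v) x u)"
    "linear (\<lambda>w. D (\<lambda>y. G y v w) x u)"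
    if "x \<in> S" for u v x
    using linear_field_D[OF S, of "\<lambda>y. G y u v"] bilinear_field_D[OF S G_field, of u] G_field that
    by (auto simp: bilinear_field_def linear_field_def bilinear_def)
  have h: "linear (\<lambda>w. c w / 2)" if "linear c" for c :: "'e \<Rightarrow> real"
    using linear_compose_scale_right[OF that, of "1/2"] by simp
  have sm: "smooth_on S (\<lambda>y. G y u v)" for u v
    using G_field by (simp add: bilinear_field_def)
  show "linear_field S (\<lambda>x w. koszul x u v w)"
    unfolding linear_field_def koszul_def
    by (auto intro!: h linear_compose_add linear_compose_sub l smooth_intros smooth_on_divide S sm)
  show "bilinear (\<lambda>u v. koszul x u v w)" if "x \<in> S"
    unfolding bilinear_def koszul_def using that
    by (auto intro!: h linear_compose_add linear_compose_sub l)
qed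

lemma christoffel_exists:
  obtains C where "\<And>u v. smooth_on S (\<lambda>x. C x u v)"
    "\<And>x u v w. x \<in> S \<Longrightarrow> G x (C x u v) w = koszul x u v w"
proof -
  have "\<exists>V. smooth_on S V \<and> (\<forall>x\<in>S. \<forall>w. G x (V x) w = koszul x u v w)" for u v
    using riesz[OF koszul_field(1)[of u v]] by metis
  then obtain V where "\<And>u v. smooth_on S (V u v)"
    "\<And>u v x w. x \<in> S \<Longrightarrow> G x (V u v x) w = koszul x u v w" by metis
  then show ?thesis using that[of "\<lambda>x u v. V u v x"] by blast
qed

lemma christoffel:
  shows \<Gamma>_field: "bilinear_field S \<Gamma>"
    and \<Gamma>_sym: "x \<in> S \<Longrightarrow> \<Gamma> x u v = \<Gamma> x v u"
    and \<Gamma>_metric: "x \<in> S \<Longrightarrow> D (\<lambda>y. G y v w) x u = G x (\<Gamma> x u v) w + G x v (\<Gamma> x u w)"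
proof -
  obtain C where sm: "\<And>u v. smooth_on S (\<lambda>x. C x u v)"
    and C: "\<And>x u v w. x \<in> S \<Longrightarrow> G x (C x u v) w = koszul x u v w"
    by (rule christoffel_exists) blast
  have sy: "C x u v = C x v u" if x: "x \<in> S" for x u v
    by (rule inner_form.nondegenerate[OF inner_form[OF x]])
      (simp add: C x koszul_def D_G_sym[OF x, of u v])
  have me: "D (\<lambda>y. G y v w) x u = G x (C x u v) w + G x v (C x u w)" if x: "x \<in> S" for x u v w
    using C[OF x, of u v w] C[OF x, of u w v] G_sym[OF x, of v "C x u w"] D_G_sym[OF x, of w v u]
    by (simp add: koszul_def)
  \<comment> \<open>The values of \<open>C\<close> were chosen separately for each pair of
    arguments, so bilinearity has to be recovered from that of the Koszul expression by
    nondegeneracy.\<close>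
  have bi: "bilinear (C x)" if x: "x \<in> S" for x
  proof -
    interpret inner_form "G x" by (rule inner_form[OF x])
    note k = bilinear_simps[OF koszul_field(2)[OF x]]
    show ?thesis unfolding bilinear_def
      by (auto intro!: linearI nondegenerate simp: C x g_simps k)
  qed
  have eq: "\<Gamma> x = C x" if "x \<in> S" for x
    using that by (intro christoffel_eqI bi sy me)
  show "bilinear_field S \<Gamma>"
    unfolding bilinear_field_def
    using eq bi smooth_on_cong[OF S _ sm] by auto
  show "x \<in> S \<Longrightarrow> \<Gamma> x u v = \<Gamma> x v u"
    "x \<in> S \<Longrightarrow> D (\<lambda>y. G y v w) x u = G x (\<Gamma> x u v) w + G x v (\<Gamma> x u w)"
    using eq sy me by auto
qed

end

subsection \<open>Lie derivatives and covariant derivatives of bilinear fields\<close>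

text \<open>The bracket of \<open>K\<close> with a constant field \<open>u\<close> is
  \<open>- D K x u\<close>, which accounts for the plus signs.\<close>

lemma lie_deriv_eq:
  assumes "bilinear (b x)"
  shows "lie_deriv K b x u v =
    D (\<lambda>y. b y u v) x (K x) + b x (D K x u) v + b x u (D K x v)"
  by (simp add: lie_deriv_def lie_bracket_def bilinear_simps[OF assms])

lemma lie_deriv_field:
  assumes S: "open S" and b: "bilinear_field S b" and K: "smooth_on S K"
  shows "bilinear_field S (lie_deriv K b)"
proof (rule bilinear_field_cong[OF S])
  note DK = linear_field_D[OF S K]
  show "bilinear_field S (\<lambda>x u v. D (\<lambda>y. b y u v) x (K x) + b x (D K x u) v + b x u (D K x v))"
    by (intro bilinear_field_add bilinear_field_left[OF S b DK] bilinear_field_right[OF S b DK]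
        bilinear_field_D_field S b K)
  show "D (\<lambda>y. b y u v) x (K x) + b x (D K x u) v + b x u (D K x v) = lie_deriv K b x u v"
    if "x \<in> S" for x u v
    using b that by (simp add: bilinear_field_def lie_deriv_eq)
qed

context metric_field
begin

lemma nabla_vec_const: "nabla_vec G u (\<lambda>_. v) = (\<lambda>x. \<Gamma> x u v)"
  by (simp add: nabla_vec_def fun_eq_iff)

lemma nabla_form_eq:
  "nabla_form G Y b x u v = D (\<lambda>y. b y u v) x Y - b x (\<Gamma> x Y u) v - b x u (\<Gamma> x Y v)"
  by (simp add: nabla_form_def nabla_vec_const)

lemma \<Gamma>_bil: "x \<in> S \<Longrightarrow> bilinear (\<Gamma> x)"
  using \<Gamma>_field by (simp add: bilinear_field_def)

lemma nabla_form_field: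
  assumes b: "bilinear_field S b"
  shows "bilinear_field S (nabla_form G Y b)"
proof (rule bilinear_field_cong[OF S])
  note L = bilinear_field_lin(2)[OF \<Gamma>_field, of Y]
  show "bilinear_field S (\<lambda>x u v. D (\<lambda>y. b y u v) x Y - b x (\<Gamma> x Y u) v - b x u (\<Gamma> x Y v))"
    by (intro bilinear_field_diff bilinear_field_left[OF S b L] bilinear_field_right[OF S b L]
        bilinear_field_D S b)
qed (simp add: nabla_form_eq)

lemma nabla_form_linear:
  assumes b: "bilinear_field S b" and x: "x \<in> S"
  shows "linear (\<lambda>Y. nabla_form G Y b x u v)"
proof -
  have l: "linear (\<lambda>Y. D (\<lambda>y. b y u v) x Y)"
    using linear_field_D[OF S, of "\<lambda>y. b y u v"] b x by (auto simp: bilinear_field_def linear_field_def)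
  have bx: "bilinear (b x)" using b x by (simp add: bilinear_field_def)
  show ?thesis
    unfolding nabla_form_eq
    by (intro linearI) (simp_all add: bilinear_simps[OF bx] bilinear_simps[OF \<Gamma>_bil[OF x]]
        linear_add[OF l] linear_cmul[OF l] algebra_simps)
qed

text \<open>The Lie derivative of the connection along \<open>K\<close>, a tensor.\<close>

definition lie_conn :: "('e \<Rightarrow> 'e) \<Rightarrow> 'e \<Rightarrow> 'e \<Rightarrow> 'e \<Rightarrow> 'e" where
  "lie_conn K x u v = D (\<lambda>y. \<Gamma> y u v) x (K x) - D K x (\<Gamma> x u v) + \<Gamma> x (D K x u) v
     + \<Gamma> x u (D K x v) + D (\<lambda>y. D K y v) x u"

lemma lie_conn_sym:
  assumes x: "x \<in> S" and K: "smooth_on S K"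
  shows "lie_conn K x u v = lie_conn K x v u"
proof -
  have "D (\<lambda>y. \<Gamma> y u v) x (K x) = D (\<lambda>y. \<Gamma> y v u) x (K x)"
    by (rule fun_cong[OF D_cong[OF S x]]) (rule \<Gamma>_sym)
  then show ?thesis
    using D_commute[OF S K x, of v u] by (simp add: lie_conn_def \<Gamma>_sym[OF x] algebra_simps)
qed

lemma D_nabla_form:
  assumes b: "bilinear_field S b" and x: "x \<in> S"
  shows "D (\<lambda>y. nabla_form G Y b y u v) x X = D (\<lambda>y. D (\<lambda>y. b y u v) y Y) x X
    - D (\<lambda>y. b y (\<Gamma> x Y u) v) x X - b x (D (\<lambda>y. \<Gamma> y Y u) x X) v
    - D (\<lambda>y. b y u (\<Gamma> x Y v)) x X - b x u (D (\<lambda>y. \<Gamma> y Y v) x X)"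
proof -
  have sm: "smooth_on S (\<lambda>y. b y u v)" "\<And>u v. smooth_on S (\<lambda>y. \<Gamma> y u v)"
    using b \<Gamma>_field by (auto simp: bilinear_field_def)
  have bx: "bilinear (b x)" using b x by (simp add: bilinear_field_def)
  have d: "(\<lambda>y. D (\<lambda>y. b y u v) y Y) differentiable (at x)"
    "(\<lambda>y. b y (\<Gamma> y Y u) v) differentiable (at x)" "(\<lambda>y. b y u (\<Gamma> y Y v)) differentiable (at x)"
    by (intro smooth_on_differentiable[OF S _ x] smooth_on_D bilinear_field_smooth[OF S b] sm smooth_on_const)+
  show ?thesis
    unfolding nabla_form_eq
    using d by (simp add: D_diff D_bilinear_field[OF S b sm(2) smooth_on_const x]
        D_bilinear_field[OF S b smooth_on_const sm(2) x] bilinear_simps[OF bx])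
qed

text \<open>The commutator of covariant and Lie derivative. Second derivatives of \<open>b\<close>
  agree by symmetry, and the first four terms on the right make up the Lie derivative of the
  3-tensor nabla b. What remains contains \<open>b\<close> undifferentiated and is the change of the
  connection along \<open>K\<close>.\<close>

lemma nabla_lie_deriv:
  assumes b: "bilinear_field S b" and K: "smooth_on S K" and x: "x \<in> S"
  shows "nabla_form G Y (lie_deriv K b) x u v =
    D (\<lambda>y. nabla_form G Y b y u v) x (K x) + nabla_form G (D K x Y) b x u v
    + nabla_form G Y b x (D K x u) v + nabla_form G Y b x u (D K x v)
    + b x (lie_conn K x Y u) v + b x u (lie_conn K x Y v)"
proof -
  have sm: "\<And>u v. smooth_on S (\<lambda>y. b y u v)" using b by (auto simp: bilinear_field_def)
  have bx: "\<And>x. x \<in> S \<Longrightarrow> bilinear (b x)" using b by (simp add: bilinear_field_def)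
  note DK = smooth_on_D[OF K]
  have "D (\<lambda>y. lie_deriv K b y u v) x Y =
      D (\<lambda>y. D (\<lambda>y. b y u v) y (K y) + b y (D K y u) v + b y u (D K y v)) x Y"
    by (rule fun_cong[OF D_cong[OF S x]]) (simp add: lie_deriv_eq bx)
  also have "\<dots> = D (\<lambda>y. D (\<lambda>y. b y u v) y (K y)) x Y + D (\<lambda>y. b y (D K y u) v) x Y
      + D (\<lambda>y. b y u (D K y v)) x Y"
    by (simp add: D_add differentiable_add smooth_on_differentiable[OF S _ x] linear_field_smooth[OF S linear_field_D[OF S sm] K]
        bilinear_field_smooth[OF S b] DK smooth_on_const)
  also have "\<dots> = D (\<lambda>y. D (\<lambda>y. b y u v) y Y) x (K x) + D (\<lambda>y. b y u v) x (D K x Y)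
      + D (\<lambda>y. b y (D K x u) v) x Y + b x (D (\<lambda>y. D K y u) x Y) v
      + D (\<lambda>y. b y u (D K x v)) x Y + b x u (D (\<lambda>y. D K y v) x Y)"
    by (simp add: D_linear_field[OF S linear_field_D[OF S sm] K x] D_bilinear_field[OF S b DK smooth_on_const x]
        D_bilinear_field[OF S b smooth_on_const DK x] bilinear_simps[OF bx[OF x]]
        D_commute[OF S sm x, of _ _ "K x" Y])
  finally have L: "D (\<lambda>y. lie_deriv K b y u v) x Y = \<dots>" .
  show ?thesis
    unfolding D_nabla_form[OF b x]
    unfolding nabla_form_eq L lie_deriv_eq[where b = b, OF bx[OF x]] lie_conn_def
    by (simp add: bilinear_simps[OF bx[OF x]] algebra_simps)
qed

section \<open>Second covariant derivative and curvature\<close>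

definition nabla2 :: "'e local_tensor2 \<Rightarrow> 'e \<Rightarrow> 'e \<Rightarrow> 'e \<Rightarrow> 'e \<Rightarrow> 'e \<Rightarrow> real" where
  "nabla2 b x X Y u v = D (\<lambda>y. nabla_form G Y b y u v) x X - nabla_form G (\<Gamma> x X Y) b x u v
     - nabla_form G Y b x (\<Gamma> x X u) v - nabla_form G Y b x u (\<Gamma> x X v)"

lemma curvature_eq:
  "curvature G x u v w = D (\<lambda>y. \<Gamma> y v w) x u - D (\<lambda>y. \<Gamma> y u w) x v + \<Gamma> x u (\<Gamma> x v w) - \<Gamma> x v (\<Gamma> x u w)"
  by (simp add: curvature_def nabla_vec_const) (simp add: nabla_vec_def)

text \<open>Curvature acts on forms as a derivation with the opposite sign. The terms with
  \<open>\<Gamma> x X Y\<close> cancel because the connection is torsion-free.\<close>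

lemma ricci_identity:
  assumes b: "bilinear_field S b" and x: "x \<in> S"
  shows "nabla2 b x X Y u v - nabla2 b x Y X u v
    = - b x (curvature G x X Y u) v - b x u (curvature G x X Y v)"
proof -
  have bx: "bilinear (b x)" and sm: "smooth_on S (\<lambda>y. b y u v)"
    using b x by (auto simp: bilinear_field_def)
  show ?thesis
    unfolding nabla2_def D_nabla_form[OF b x]
    unfolding nabla_form_eq curvature_eq
    using D_commute[OF S sm x, of X Y] \<Gamma>_sym[OF x, of X Y]
    by (simp add: bilinear_simps[OF bx] algebra_simps)
qed

lemma curvature_skew: "curvature G x u v w = - curvature G x v u w"
  by (simp add: curvature_def)

lemma curvature_bianchi:
  assumes x: "x \<in> S"
  shows "curvature G x u v w + curvature G x v w u + curvature G x w u v = 0"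
proof -
  have "D (\<lambda>y. \<Gamma> y u v) x w = D (\<lambda>y. \<Gamma> y v u) x w" for u v w
    by (rule fun_cong[OF D_cong[OF S x]]) (rule \<Gamma>_sym)
  from this[of u v w] this[of v w u] this[of w u v] show ?thesis
    unfolding curvature_eq using \<Gamma>_sym[OF x] by (simp add: algebra_simps)
qed

lemma curvature_linear:
  assumes x: "x \<in> S"
  shows "linear (\<lambda>u. curvature G x u v w)"
proof -
  have "linear (\<lambda>u. D (\<lambda>y. \<Gamma> y v w) x u)" "linear (\<lambda>u. D (\<lambda>y. \<Gamma> y u w) x v)"
    using linear_field_D[OF S, of "\<lambda>y. \<Gamma> y v w"] bilinear_field_D[OF S \<Gamma>_field, of v] \<Gamma>_field x
    by (auto simp: bilinear_field_def linear_field_def bilinear_def)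
  note l = this[THEN linear_add] this[THEN linear_cmul]
  show ?thesis
    unfolding curvature_eq
    by (intro linearI) (simp_all add: bilinear_simps[OF \<Gamma>_bil[OF x]] l algebra_simps)
qed

lemma nabla_metric: "x \<in> S \<Longrightarrow> nabla_form G Y G x u v = 0"
  by (simp add: nabla_form_eq \<Gamma>_metric)

text \<open>This is the Ricci identity for the metric itself, whose covariant derivatives
  vanish.\<close>

lemma curvature_metric_skew:
  assumes x: "x \<in> S"
  shows "G x (curvature G x X Y u) v = - G x u (curvature G x X Y v)"
proof -
  have "D (\<lambda>y. nabla_form G Y G y u v) x X = D (\<lambda>y. 0) x X" for X Y
    by (rule fun_cong[OF D_cong[OF S x]]) (rule nabla_metric)
  then have "nabla2 G x X Y u v = 0" for X Y
    by (simp add: nabla2_def nabla_metric[OF x])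
  with ricci_identity[OF G_field x, of X Y u v] show ?thesis by simp
qed

text \<open>Self-adjointness of the Jacobi operator e -> R(e, Y)Y. Pair the Bianchi identity for e,
  Y, f with Y: one term vanishes by metric skewness, and the other two are the two sides.\<close>

lemma curvature_selfadjoint:
  assumes x: "x \<in> S"
  shows "G x (curvature G x e Y Y) f = G x e (curvature G x f Y Y)"
proof -
  interpret inner_form "G x" by (rule inner_form[OF x])
  have "G x (curvature G x e Y f + curvature G x Y f e + curvature G x f e Y) Y = 0"
    by (simp add: curvature_bianchi[OF x] g_simps)
  then have "G x (curvature G x e Y f) Y + G x (curvature G x Y f e) Y + G x (curvature G x f e Y) Y = 0"
    by (simp add: g_simps)
  moreover have "G x (curvature G x f e Y) Y = 0"
    using curvature_metric_skew[OF x, of f e Y Y] sym[of Y] by simp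
  moreover have "G x (curvature G x e Y f) Y = - G x (curvature G x e Y Y) f"
    using curvature_metric_skew[OF x, of e Y f Y] sym[of f] by simp
  moreover have "G x (curvature G x Y f e) Y = G x e (curvature G x f Y Y)"
    using curvature_metric_skew[OF x, of Y f e Y] curvature_skew[of x f Y Y] by (simp add: g_simps)
  ultimately show ?thesis by simp
qed

subsection \<open>The codifferential of a conformal-Killing form on an Einstein manifold\<close>

text \<open>
  The conformal-Killing equation restricted to the diagonal; \<open>\<xi>\<close> is then the codifferential, and
  the exterior derivative drops out.
\<close>

definition ck :: "'e local_tensor2 \<Rightarrow> ('e \<Rightarrow> 'e) \<Rightarrow> bool" where
  "ck \<psi> \<xi> \<longleftrightarrow> (\<forall>x\<in>S. \<forall>Y v. nabla_form G Y \<psi> x Y v =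
     - (1 / (real DIM('e) - 1)) * (G x Y Y * G x (\<xi> x) v - G x Y v * G x (\<xi> x) Y))"

text \<open>Polarisation: expand the diagonal equation at \<open>Y + Z\<close>. It controls only the
  symmetrised derivative, which is what differentiating along the diagonal produces.\<close>

lemma ck_polar:
  assumes \<psi>: "bilinear_field S \<psi>" and ck: "ck \<psi> \<xi>" and x: "x \<in> S"
  shows "nabla_form G Y \<psi> x Z v + nabla_form G Z \<psi> x Y v =
     - (1 / (real DIM('e) - 1)) * (2 * G x Y Z * G x (\<xi> x) v - G x Y v * G x (\<xi> x) Z - G x Z v * G x (\<xi> x) Y)"
proof -
  interpret inner_form "G x" by (rule inner_form[OF x])
  have n: "bilinear (nabla_form G Y \<psi> x)" for Y
    using nabla_form_field[OF \<psi>] x by (simp add: bilinear_field_def)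
  note l = nabla_form_linear[OF \<psi> x]
  have k: "nabla_form G Y \<psi> x Y v =
     - (1 / (real DIM('e) - 1)) * (G x Y Y * G x (\<xi> x) v - G x Y v * G x (\<xi> x) Y)" for Y
    using ck x by (auto simp: ck_def)
  have "nabla_form G (Y + Z) \<psi> x (Y + Z) v = nabla_form G Y \<psi> x Y v + nabla_form G Z \<psi> x Z v
      + (nabla_form G Y \<psi> x Z v + nabla_form G Z \<psi> x Y v)"
    by (simp add: bilinear_simps[OF n] linear_add[OF l])
  then have "nabla_form G Y \<psi> x Z v + nabla_form G Z \<psi> x Y v =
    nabla_form G (Y + Z) \<psi> x (Y + Z) v - nabla_form G Y \<psi> x Y v - nabla_form G Z \<psi> x Z v"
    by simp
  also have "\<dots> = - (1 / (real DIM('e) - 1)) * (2 * G x Y Z * G x (\<xi> x) v - G x Y v * G x (\<xi> x) Z - G x Z v * G x (\<xi> x) Y)"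
    unfolding k by (simp add: g_simps sym[of Z Y] algebra_simps)
  finally show ?thesis .
qed

text \<open>The product rule leaves the derivatives of the metric unevaluated, with
  \<open>\<xi>\<close> frozen at \<open>x\<close>. They are later expressed through the connection
  in \<open>nabla2_ck\<close> and through the Lie derivative of the metric in
  \<open>lie_deriv_ck\<close>.\<close>

lemma D_ck:
  assumes \<xi>: "smooth_on S \<xi>" and ck: "ck \<psi> \<xi>" and x: "x \<in> S"
  shows "D (\<lambda>y. nabla_form G Y \<psi> y Y v) x X = - (1 / (real DIM('e) - 1)) *
      (G x Y Y * (D (\<lambda>y. G y (\<xi> x) v) x X + G x (D \<xi> x X) v) + D (\<lambda>y. G y Y Y) x X * G x (\<xi> x) v
      - G x Y v * (D (\<lambda>y. G y (\<xi> x) Y) x X + G x (D \<xi> x X) Y) - D (\<lambda>y. G y Y v) x X * G x (\<xi> x) Y)"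
proof -
  define c where "c = - (1 / (real DIM('e) - 1))"
  have smG: "smooth_on S (\<lambda>y. G y u w)" "smooth_on S (\<lambda>y. G y (\<xi> y) w)" for u w
    using G_field bilinear_field_smooth[OF S G_field \<xi> smooth_on_const] by (auto simp: bilinear_field_def)
  have d: "(\<lambda>y. G y u w) differentiable (at x)" "(\<lambda>y. G y (\<xi> y) w) differentiable (at x)" for u w
    by (intro smooth_on_differentiable[OF S _ x] smG)+
  have "D (\<lambda>y. nabla_form G Y \<psi> y Y v) x X
      = D (\<lambda>y. c * (G y Y Y * G y (\<xi> y) v - G y Y v * G y (\<xi> y) Y)) x X"
    by (rule fun_cong[OF D_cong[OF S x]]) (use ck in \<open>auto simp: ck_def c_def\<close>)
  also have "\<dots> = c * (G x Y Y * D (\<lambda>y. G y (\<xi> y) v) x X + D (\<lambda>y. G y Y Y) x X * G x (\<xi> x) v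
      - (G x Y v * D (\<lambda>y. G y (\<xi> y) Y) x X + D (\<lambda>y. G y Y v) x X * G x (\<xi> x) Y))"
    using d by (simp add: D_cmult D_diff D_mult differentiable_diff differentiable_mult)
  finally have 1: "D (\<lambda>y. nabla_form G Y \<psi> y Y v) x X = \<dots>" .
  have 2: "D (\<lambda>y. G y (\<xi> y) w) x X = D (\<lambda>y. G y (\<xi> x) w) x X + G x (D \<xi> x X) w" for w
    by (simp add: D_bilinear_field[OF S G_field \<xi> smooth_on_const x] bilinear_simps[OF G_bil[OF x]])
  show ?thesis unfolding 1 2 c_def by (simp add: algebra_simps)
qed

text \<open>Since the metric is parallel, differentiating the diagonal equation hits
  \<open>\<xi>\<close> alone. The two corrections by \<open>\<Gamma> x X Y\<close>, one in each
  diagonal slot, occur exactly in the combination given by \<open>ck_polar\<close>.\<close>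

lemma nabla2_ck:
  assumes \<psi>: "bilinear_field S \<psi>" and \<xi>: "smooth_on S \<xi>" and ck: "ck \<psi> \<xi>" and x: "x \<in> S"
  shows "nabla2 \<psi> x X Y Y v = - (1 / (real DIM('e) - 1)) *
    (G x Y Y * G x (nabla_vec G X \<xi> x) v - G x Y v * G x (nabla_vec G X \<xi> x) Y)"
proof -
  interpret inner_form "G x" by (rule inner_form[OF x])
  define c where "c = - (1 / (real DIM('e) - 1))"
  note 1 = D_ck[OF \<xi> ck x, of Y v X, folded c_def]
  have 2: "nabla_form G (\<Gamma> x X Y) \<psi> x Y v + nabla_form G Y \<psi> x (\<Gamma> x X Y) v =
     c * (2 * G x (\<Gamma> x X Y) Y * G x (\<xi> x) v - G x (\<Gamma> x X Y) v * G x (\<xi> x) Y - G x Y v * G x (\<xi> x) (\<Gamma> x X Y))"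
    unfolding c_def by (rule ck_polar[OF \<psi> ck x])
  have 3: "nabla_form G Y \<psi> x Y (\<Gamma> x X v) =
     c * (G x Y Y * G x (\<xi> x) (\<Gamma> x X v) - G x Y (\<Gamma> x X v) * G x (\<xi> x) Y)"
    using ck x by (simp add: ck_def c_def)
  have "nabla2 \<psi> x X Y Y v = D (\<lambda>y. nabla_form G Y \<psi> y Y v) x X
      - (nabla_form G (\<Gamma> x X Y) \<psi> x Y v + nabla_form G Y \<psi> x (\<Gamma> x X Y) v) - nabla_form G Y \<psi> x Y (\<Gamma> x X v)"
    by (simp add: nabla2_def)
  also have "\<dots> = c * (G x Y Y * G x (nabla_vec G X \<xi> x) v - G x Y v * G x (nabla_vec G X \<xi> x) Y)"
    unfolding 1 2 3 \<Gamma>_metric[OF x] nabla_vec_def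
    by (simp add: g_simps sym[of Y "\<Gamma> x X Y"] algebra_simps)
  finally show ?thesis by (simp add: c_def)
qed

definition form_field :: "'e local_tensor2 \<Rightarrow> bool" where
  "form_field \<psi> \<longleftrightarrow> bilinear_field S \<psi> \<and> (\<forall>x\<in>S. \<forall>u v. \<psi> x u v = - \<psi> x v u)"

lemma form_field:
  assumes "form_field \<psi>"
  shows "bilinear_field S \<psi>" "x \<in> S \<Longrightarrow> \<psi> x u v = - \<psi> x v u"
  using assms unfolding form_field_def by blast+

lemma nabla_form_alt:
  assumes form: "form_field \<psi>" and x: "x \<in> S"
  shows "nabla_form G Y \<psi> x u v = - nabla_form G Y \<psi> x v u"
proof -
  note \<psi> = form_field(1)[OF form] and alt = form_field(2)[OF form]
  have "D (\<lambda>y. \<psi> y u v) x Y = D (\<lambda>y. - \<psi> y v u) x Y"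
    by (rule fun_cong[OF D_cong[OF S x]]) (rule alt)
  also have "\<dots> = - D (\<lambda>y. \<psi> y v u) x Y"
    using \<psi> by (intro D_minus smooth_on_differentiable[OF S _ x]) (simp add: bilinear_field_def)
  finally show ?thesis
    unfolding nabla_form_eq using alt[OF x, of "\<Gamma> x Y u" v] alt[OF x, of u "\<Gamma> x Y v"] by simp
qed

lemma nabla2_alt:
  assumes form: "form_field \<psi>" and x: "x \<in> S"
  shows "nabla2 \<psi> x X Y u v = - nabla2 \<psi> x X Y v u"
proof -
  note \<psi> = form_field(1)[OF form] and alt = form_field(2)[OF form]
  note n = nabla_form_alt[OF form]
  have "D (\<lambda>y. nabla_form G Y \<psi> y u v) x X = D (\<lambda>y. - nabla_form G Y \<psi> y v u) x X"
    by (rule fun_cong[OF D_cong[OF S x]]) (rule n)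
  also have "\<dots> = - D (\<lambda>y. nabla_form G Y \<psi> y v u) x X"
    using nabla_form_field[OF \<psi>] by (intro D_minus smooth_on_differentiable[OF S _ x]) (simp add: bilinear_field_def)
  finally show ?thesis
    unfolding nabla2_def using n[OF x, of "\<Gamma> x X Y" u v] n[OF x, of Y "\<Gamma> x X u" v] n[OF x, of Y u "\<Gamma> x X v"] by simp
qed

lemma nabla_vec_linear:
  assumes \<xi>: "smooth_on S \<xi>" and x: "x \<in> S"
  shows "linear (\<lambda>X. nabla_vec G X \<xi> x)"
  using linear_field_D[OF S \<xi>] x \<Gamma>_bil[OF x]
  by (auto simp: nabla_vec_def linear_field_def bilinear_def intro!: linear_compose_add)

text \<open>Contract the Ricci identity for \<open>\<psi>\<close> over \<open>e, Y, e, Y\<close>.\<close>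

lemma ck_contraction:
  assumes form: "form_field \<psi>"
    and \<xi>: "smooth_on S \<xi>" and ck: "ck \<psi> \<xi>" and x: "x \<in> S"
    and ein: "\<And>v w. ricci G x v w = a * G x v w" and dim: "2 \<le> DIM('e)"
    and E: "inner_form.onb (G x) E"
  shows "(real DIM('e) - 2) * G x (nabla_vec G Y \<xi> x) Y
    + G x Y Y * (\<Sum>e\<in>E. G x (nabla_vec G e \<xi> x) e) = 0"
proof -
  note \<psi> = form_field(1)[OF form] and alt = form_field(2)[OF form]
  interpret inner_form "G x" by (rule inner_form[OF x])
  let ?A = "\<lambda>X v. G x (nabla_vec G X \<xi> x) v" and ?R = "curvature G x"
  define c where "c = 1 / (real DIM('e) - 1)"
  have c: "c \<noteq> 0" "c * (real DIM('e) - 1) = 1" using dim by (auto simp: c_def)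
  have bx: "bilinear (\<psi> x)" using \<psi> x by (simp add: bilinear_field_def)
  have Ric: "(\<Sum>e\<in>E. G x (?R e Y z) e) = a * G x Y z" for z
    using trace_onb[OF E curvature_linear[OF x], of Y z] ein[of Y z] by (simp add: ricci_def)
  \<comment> \<open>The Einstein condition enters here: contraction with metric skewness gives the
    Ricci operator, which is a scalar, so the first curvature sum becomes a multiple of psi(Y,
    Y).\<close>
  have "(\<Sum>e\<in>E. ?R e Y e) = - a *\<^sub>R Y"
  proof (rule nondegenerate)
    fix z
    have "G x (\<Sum>e\<in>E. ?R e Y e) z = - (\<Sum>e\<in>E. G x (?R e Y z) e)"
      by (simp add: g_simps sum_negf[symmetric] curvature_metric_skew[OF x, of _ Y _ z] sym[of _ "?R _ Y z"])
    then show "G x (\<Sum>e\<in>E. ?R e Y e) z = G x (- a *\<^sub>R Y) z" by (simp add: Ric g_simps)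
  qed
  moreover have "(\<Sum>e\<in>E. \<psi> x (?R e Y e) Y) = \<psi> x (\<Sum>e\<in>E. ?R e Y e) Y"
    by (simp add: bilinear_simps[OF bx])
  moreover have "\<psi> x Y Y = 0" using alt[OF x, of Y Y] by simp
  ultimately have 1: "(\<Sum>e\<in>E. \<psi> x (?R e Y e) Y) = 0" by (simp add: bilinear_simps[OF bx])
  have 2: "(\<Sum>e\<in>E. \<psi> x e (?R e Y Y)) = 0"
    by (rule sum_selfadjoint_alternating[OF E bx alt[OF x]]) (rule curvature_selfadjoint[OF x])
  note ck2 = nabla2_ck[OF \<psi> \<xi> ck x, folded c_def]
  have 3: "(\<Sum>e\<in>E. nabla2 \<psi> x e Y e Y) = c * (G x Y Y * (\<Sum>e\<in>E. ?A e e) - ?A Y Y)"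
  proof -
    have "?A Y Y = ?A (\<Sum>e\<in>E. G x Y e *\<^sub>R e) Y" using onb_expand[OF E, of Y] by simp
    also have "\<dots> = (\<Sum>e\<in>E. G x Y e * ?A e Y)"
      by (simp add: linear_sum[OF nabla_vec_linear[OF \<xi> x]] linear_cmul[OF nabla_vec_linear[OF \<xi> x]] g_simps)
    finally have A: "?A Y Y = (\<Sum>e\<in>E. G x Y e * ?A e Y)" .
    \<comment> \<open>\<open>nabla2_ck\<close> needs the direction and the first argument to
      coincide; swapping the last two arguments moves \<open>Y\<close> there at the cost of a
      sign.\<close>
    have "nabla2 \<psi> x e Y e Y = c * (G x Y Y * ?A e e - G x Y e * ?A e Y)" for e
      unfolding nabla2_alt[OF form x, of e Y e Y] ck2 by simp
    then show ?thesis by (simp add: A sum_distrib_left[symmetric] sum_subtractf)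
  qed
  have 4: "(\<Sum>e\<in>E. nabla2 \<psi> x Y e e Y) = - ?A Y Y"
  proof -
    have "(\<Sum>e\<in>E. nabla2 \<psi> x Y e e Y) = - c * ((\<Sum>e\<in>E. G x e e * ?A Y Y) - (\<Sum>e\<in>E. ?A Y e * G x e Y))"
      unfolding ck2 by (simp add: sum_distrib_left[symmetric] sum_subtractf mult.commute sum_negf)
    \<comment> \<open>The trace of the metric contributes m and the remaining sum contributes 1; the
      difference m - 1 cancels \<open>c\<close>.\<close>
    also have "\<dots> = - c * (real DIM('e) * ?A Y Y - ?A Y Y)"
      by (simp only: sum_distrib_right[symmetric] onb_card[OF E] onb_inner[OF E])
    also have "\<dots> = - (c * (real DIM('e) - 1)) * ?A Y Y" by (simp add: algebra_simps)
    finally show ?thesis by (simp add: c)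
  qed
  have "(\<Sum>e\<in>E. nabla2 \<psi> x e Y e Y) - (\<Sum>e\<in>E. nabla2 \<psi> x Y e e Y) = 0"
    using 1 2 by (simp add: sum_subtractf[symmetric] ricci_identity[OF \<psi> x]) (simp add: sum_subtractf sum_negf)
  then have "c * (G x Y Y * (\<Sum>e\<in>E. ?A e e) - ?A Y Y) + (c * (real DIM('e) - 1)) * ?A Y Y = 0"
    unfolding 3 4 c(2) by simp
  then have "c * ((real DIM('e) - 2) * ?A Y Y + G x Y Y * (\<Sum>e\<in>E. ?A e e)) = 0"
    by (simp add: algebra_simps)
  then show ?thesis using c by simp
qed

text \<open>Summing \<open>ck_contraction\<close> over an orthonormal basis in \<open>Y\<close>
  gives the coefficient (m - 2) + m = 2(m - 1), which is nonzero.\<close>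

lemma ck_divergence_free:
  assumes form: "form_field \<psi>"
    and \<xi>: "smooth_on S \<xi>" and ck: "ck \<psi> \<xi>" and x: "x \<in> S"
    and ein: "\<And>v w. ricci G x v w = a * G x v w" and dim: "2 \<le> DIM('e)"
    and E: "inner_form.onb (G x) E"
  shows "(\<Sum>e\<in>E. G x (nabla_vec G e \<xi> x) e) = 0"
proof -
  interpret inner_form "G x" by (rule inner_form[OF x])
  define t where "t = (\<Sum>e\<in>E. G x (nabla_vec G e \<xi> x) e)"
  have "(\<Sum>Y\<in>E. (real DIM('e) - 2) * G x (nabla_vec G Y \<xi> x) Y + G x Y Y * t) = 0"
    unfolding t_def by (intro sum.neutral ballI ck_contraction[OF assms])
  then have "(real DIM('e) - 2) * t + real DIM('e) * t = 0"
    by (simp add: sum.distrib sum_distrib_left[symmetric] sum_distrib_right[symmetric] onb_card[OF E] t_def)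
  then have "2 * (real DIM('e) - 1) * t = 0" by (simp add: algebra_simps)
  then show ?thesis using dim by (simp add: t_def)
qed

lemma lie_metric:
  assumes x: "x \<in> S"
  shows "lie_deriv \<xi> G x u v = G x (nabla_vec G u \<xi> x) v + G x u (nabla_vec G v \<xi> x)"
  unfolding lie_deriv_eq[where b = G, OF G_bil[OF x]] \<Gamma>_metric[OF x] nabla_vec_def
  by (simp add: bilinear_simps[OF G_bil[OF x]] \<Gamma>_sym[OF x, of "\<xi> x"])

lemma lie_metric_sym: "x \<in> S \<Longrightarrow> lie_deriv \<xi> G x u v = lie_deriv \<xi> G x v u"
  by (simp add: lie_metric G_sym)

text \<open>With zero divergence the contraction says that the symmetric form L g vanishes on the
  diagonal, hence everywhere by polarisation.\<close>

lemma ck_killing: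
  assumes form: "form_field \<psi>"
    and \<xi>: "smooth_on S \<xi>" and ck: "ck \<psi> \<xi>" and x: "x \<in> S"
    and ein: "\<And>v w. ricci G x v w = a * G x v w" and dim: "2 < DIM('e)"
  shows "lie_deriv \<xi> G x u v = 0"
proof -
  note E = unit_frame_onb[OF x]
  have h: "lie_deriv \<xi> G x Y Y = 0" for Y
  proof -
    have "2 \<le> DIM('e)" using dim by simp
    note a = form \<xi> ck x ein this E
    have "(real DIM('e) - 2) * G x (nabla_vec G Y \<xi> x) Y = 0"
      using ck_contraction[OF a, of Y] ck_divergence_free[OF a] by simp
    then show ?thesis using dim by (simp add: lie_metric[OF x] G_sym[OF x, of Y])
  qed
  have b: "bilinear (lie_deriv \<xi> G x)"
    using lie_deriv_field[OF S G_field \<xi>] x by (simp add: bilinear_field_def)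
  from h[of "u + v"] h[of u] h[of v] lie_metric_sym[OF x, of \<xi> u v] show ?thesis
    by (simp add: bilinear_simps[OF b])
qed

end

subsection \<open>Lie derivatives of conformal-Killing forms\<close>

context inner_form
begin

text \<open>In dimension two a 2-form has top degree, and an endomorphism acts on it as a derivation
  through multiplication by its trace.\<close>

lemma traceless_kills_forms:
  assumes E: "onb E" and dim: "DIM('e) = 2" and L: "linear L" and tr: "(\<Sum>e\<in>E. g (L e) e) = 0"
    and w: "bilinear w" "\<And>u v. w u v = - w v u"
  shows "w (L u) v + w u (L v) = (0::real)"
proof -
  obtain e f where E_eq: "E = {e, f}" "e \<noteq> f" and ex: "\<And>u. u = g u e *\<^sub>R e + g u f *\<^sub>R f"
    by (rule onb_two[OF E dim]) blast
  define q where "q u v = w (L u) v + w u (L v)" for u v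
  have lL: "linear (\<lambda>u. w (L u) v)" "linear (\<lambda>v. w u (L v))" for u v
    using linear_compose[OF L, of "\<lambda>u. w u v"] linear_compose[OF L, of "w u"] w(1)
    by (auto simp: bilinear_def comp_def)
  have q: "bilinear q"
    unfolding bilinear_def q_def using lL w(1) by (auto simp: bilinear_def intro!: linear_compose_add)
  have w0: "w u u = 0" for u using w(2)[of u u] by simp
  have qa: "q u v = - q v u" for u v
    using w(2)[of "L u" v] w(2)[of u "L v"] by (simp add: q_def)
  have q0: "q u u = 0" for u using qa[of u u] by simp
  have "w (L e) f = g (L e) e * w e f"
    by (subst ex[of "L e"]) (simp add: bilinear_simps[OF w(1)] w0)
  moreover have "w e (L f) = g (L f) f * w e f"
    by (subst ex[of "L f"]) (simp add: bilinear_simps[OF w(1)] w0)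
  ultimately have "q e f = (g (L e) e + g (L f) f) * w e f"
    by (simp add: q_def algebra_simps)
  also have "\<dots> = 0" using tr E_eq by simp
  finally have qef: "q e f = 0" "q f e = 0" using qa[of f e] by simp_all
  have "q u v = q (g u e *\<^sub>R e + g u f *\<^sub>R f) (g v e *\<^sub>R e + g v f *\<^sub>R f)"
    using ex[of u] ex[of v] by simp
  also have "\<dots> = 0" by (simp add: bilinear_simps[OF q] q0 qef)
  finally show ?thesis by (simp add: q_def)
qed

text \<open>The left side of the first identity is the Kulkarni-Nomizu product of \<open>h\<close>
  and \<open>g\<close> at (u, v, u, w). In dimension two such a tensor has one free component, a
  multiple of the trace of \<open>h\<close>. The second identity is the case w = v; it expresses
  tracelessness polynomially, in vectors that need not be orthonormal.\<close>

lemma traceless_symmetric_dim2: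
  assumes E: "onb E" and dim: "DIM('e) = 2" and tr: "(\<Sum>e\<in>E. h e e) = 0"
    and h: "bilinear h" "\<And>u v. h u v = (h v u :: real)"
  shows "h u u * g v w + g u u * h v w - h u w * g u v - g u w * h u v = 0" (is ?A)
    and "h u u * g v v - 2 * h u v * g u v + h v v * g u u = 0" (is ?B)
proof -
  obtain e f where E_eq: "E = {e, f}" "e \<noteq> f" and on: "g e e = 1" "g f f = 1" "g e f = 0" "g f e = 0"
    and ex: "\<And>u. u = g u e *\<^sub>R e + g u f *\<^sub>R f"
    by (rule onb_two[OF E dim]) blast
  have tr': "h f f = - h e e" using tr E_eq by simp
  have hfe: "h f e = h e f" by (rule h(2))
  have H: "h u v = g u e * g v e * h e e + (g u e * g v f + g u f * g v e) * h e f - g u f * g v f * h e e" for u v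
    by (subst ex[of u], subst ex[of v]) (simp add: bilinear_simps[OF h(1)] tr' hfe algebra_simps)
  have G: "g u v = g u e * g v e + g u f * g v f" for u v
    by (subst ex[of u], subst ex[of v]) (simp add: g_simps on algebra_simps)
  show ?A
    unfolding H[of u u] H[of v w] H[of u w] H[of u v] G[of v w] G[of u u] G[of u v] G[of u w]
    by algebra
  show ?B
    unfolding H[of u u] H[of v v] H[of u v] G[of v v] G[of u u] G[of u v] by algebra
qed

end

context metric_field
begin

lemma nabla_lie_metric:
  assumes K: "smooth_on S K" and x: "x \<in> S"
  shows "nabla_form G Y (lie_deriv K G) x u v = G x (lie_conn K x Y u) v + G x u (lie_conn K x Y v)"
proof -
  have "D (\<lambda>y. nabla_form G Y G y u v) x (K x) = D (\<lambda>y. 0) x (K x)"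
    by (rule fun_cong[OF D_cong[OF S x]]) (rule nabla_metric)
  then show ?thesis
    unfolding nabla_lie_deriv[OF G_field K x] by (simp add: nabla_metric[OF x])
qed

lemma lie_conn_linear:
  assumes K: "smooth_on S K" and x: "x \<in> S"
  shows "linear (lie_conn K x u)"
proof -
  have "linear (D K x)" "linear (\<lambda>v. D (\<lambda>y. D K y v) x u)" "linear (\<lambda>v. D (\<lambda>y. \<Gamma> y u v) x (K x))"
    using linear_field_D[OF S K] linear_field_D_arg[OF S linear_field_D[OF S K]]
      bilinear_field_D[OF S \<Gamma>_field] x
    by (auto simp: linear_field_def bilinear_field_def bilinear_def)
  note l = this[THEN linear_add] this[THEN linear_cmul]
  show ?thesis
    unfolding lie_conn_def
    by (intro linearI) (simp_all add: bilinear_simps[OF \<Gamma>_bil[OF x]] l algebra_simps)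
qed

text \<open>As L g vanishes on all of \<open>S\<close>, so does its covariant derivative, which
  makes C skew in its last two slots after lowering an index. It is symmetric in the first two, and
  a trilinear form with both symmetries is zero.\<close>

lemma lie_conn_killing:
  assumes K: "smooth_on S K" and h: "\<And>x u v. x \<in> S \<Longrightarrow> lie_deriv K G x u v = 0" and x: "x \<in> S"
  shows "lie_conn K x u v = 0"
proof (rule inner_form.nondegenerate[OF inner_form[OF x]])
  fix w
  have "nabla_form G Y (lie_deriv K G) x u v = 0" for Y u v
  proof -
    have "D (\<lambda>y. lie_deriv K G y u v) x Y = D (\<lambda>y. 0) x Y"
      by (rule fun_cong[OF D_cong[OF S x]]) (rule h)
    then show ?thesis by (simp add: nabla_form_eq h[OF x])
  qed
  then have a: "G x (lie_conn K x Y u) v = - G x (lie_conn K x Y v) u" for Y u v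
    using nabla_lie_metric[OF K x, of Y u v] G_sym[OF x, of u] by simp
  note s = lie_conn_sym[OF x K]
  have "G x (lie_conn K x u v) w = - G x (lie_conn K x u v) w"
    using a[of u v w] a[of w u v] a[of v w u] s[of u v] s[of u w] s[of v w] by simp
  then show "G x (lie_conn K x u v) w = G x 0 w"
    by (simp add: bilinear_simps[OF G_bil[OF x]])
qed

text \<open>The trace of C_u is half the trace of nabla_u (L g), that is, half the derivative of the
  trace of L g, which is zero.\<close>

lemma lie_conn_traceless:
  assumes K: "smooth_on S K" and dim: "DIM('e) = 2"
    and h: "\<And>x E. x \<in> S \<Longrightarrow> inner_form.onb (G x) E \<Longrightarrow> (\<Sum>e\<in>E. lie_deriv K G x e e) = 0"
    and x: "x \<in> S" and E: "inner_form.onb (G x) E"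
  shows "(\<Sum>e\<in>E. G x (lie_conn K x u e) e) = 0"
proof -
  interpret inner_form "G x" by (rule inner_form[OF x])
  obtain e f where E_eq: "E = {e, f}" "e \<noteq> f"
    and on: "G x e e = 1" "G x f f = 1" "G x e f = 0" "G x f e = 0"
    and ex: "\<And>u. u = G x u e *\<^sub>R e + G x u f *\<^sub>R f"
    by (rule onb_two[OF E dim]) blast
  let ?h = "lie_deriv K G"
  have hb: "bilinear_field S ?h" by (rule lie_deriv_field[OF S G_field K])
  have hx: "bilinear (?h y)" if "y \<in> S" for y using hb that by (simp add: bilinear_field_def)
  have d: "(\<lambda>y. ?h y v w) differentiable (at x)" "(\<lambda>y. G y v w) differentiable (at x)" for v w
    using hb G_field by (auto intro: smooth_on_differentiable[OF S _ x] simp: bilinear_field_def)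
  \<comment> \<open>The constant vectors \<open>e\<close> and \<open>f\<close> are orthonormal at
    \<open>x\<close> only. This polynomial is the trace multiplied by the Gram determinant of
    \<open>e\<close> and \<open>f\<close>, so it vanishes at nearby points too and no moving frame
    has to be differentiated.\<close>
  have "D (\<lambda>y. ?h y e e * G y f f - 2 * (?h y e f * G y e f) + ?h y f f * G y e e) x u = D (\<lambda>y. 0) x u"
  proof (rule fun_cong[OF D_cong[OF S x]])
    fix y assume y: "y \<in> S"
    note E' = unit_frame_onb[OF y]
    show "?h y e e * G y f f - 2 * (?h y e f * G y e f) + ?h y f f * G y e e = 0"
      using inner_form.traceless_symmetric_dim2(2)[OF inner_form[OF y] E' dim h[OF y E'] hx[OF y]
          lie_metric_sym[OF y], of e f] by simp
  qed
  moreover have "D (\<lambda>y. ?h y e e * G y f f - 2 * (?h y e f * G y e f) + ?h y f f * G y e e) x u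
    = D (\<lambda>y. ?h y e e) x u + D (\<lambda>y. ?h y f f) x u
      + ?h x e e * D (\<lambda>y. G y f f) x u - 2 * (?h x e f * D (\<lambda>y. G y e f) x u) + ?h x f f * D (\<lambda>y. G y e e) x u"
    using d by (simp add: D_add D_diff D_mult D_cmult differentiable_add differentiable_diff differentiable_mult on)
  ultimately have 1: "D (\<lambda>y. ?h y e e) x u + D (\<lambda>y. ?h y f f) x u + ?h x e e * D (\<lambda>y. G y f f) x u
      - 2 * (?h x e f * D (\<lambda>y. G y e f) x u) + ?h x f f * D (\<lambda>y. G y e e) x u = 0" by simp
  have tr: "?h x e e + ?h x f f = 0" using h[OF x E] E_eq by simp
  define a b c d where ab: "a = G x (\<Gamma> x u e) e" "b = G x (\<Gamma> x u e) f" "c = G x (\<Gamma> x u f) e" "d = G x (\<Gamma> x u f) f"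
  have ge: "\<Gamma> x u e = a *\<^sub>R e + b *\<^sub>R f" "\<Gamma> x u f = c *\<^sub>R e + d *\<^sub>R f"
    unfolding ab by (rule ex)+
  note hx = bilinear_simps[OF hx[OF x]]
  have De: "D (\<lambda>y. ?h y e e) x u = nabla_form G u ?h x e e + 2 * (a * ?h x e e + b * ?h x e f)"
    unfolding nabla_form_eq ge by (simp add: hx lie_metric_sym[OF x, of _ f e])
  have Df: "D (\<lambda>y. ?h y f f) x u = nabla_form G u ?h x f f + 2 * (c * ?h x e f + d * ?h x f f)"
    unfolding nabla_form_eq ge by (simp add: hx lie_metric_sym[OF x, of _ f e])
  have g: "D (\<lambda>y. G y f f) x u = 2 * d" "D (\<lambda>y. G y e e) x u = 2 * a" "D (\<lambda>y. G y e f) x u = b + c"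
    unfolding \<Gamma>_metric[OF x] ge by (simp_all add: g_simps on)
  \<comment> \<open>The connection terms with \<open>b\<close> and \<open>c\<close> cancel, and
    those with \<open>a\<close> and \<open>d\<close> assemble into a multiple of the trace of
    \<open>?h\<close> at \<open>x\<close>.\<close>
  have "nabla_form G u ?h x e e + nabla_form G u ?h x f f + 2 * (a + d) * (?h x e e + ?h x f f) = 0"
    using 1 unfolding De Df g by (simp add: algebra_simps)
  then have "nabla_form G u ?h x e e + nabla_form G u ?h x f f = 0" by (simp add: tr)
  then show ?thesis
    unfolding nabla_lie_metric[OF K x] using E_eq by (simp add: sym[of e] sym[of f])
qed

text \<open>
  Either \<open>\<xi>\<^sub>1\<close> is Killing, or the dimension is two, where every two-form is conformal-Killing and
  \<open>\<xi>\<^sub>1\<close> is merely divergence-free. Both cases yield the facts \<open>conn\<close> and \<open>metric\<close>.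
\<close>

lemma lie_deriv_ck:
  assumes form: "form_field \<psi>\<^sub>1" "form_field \<psi>\<^sub>2" and \<xi>: "smooth_on S \<xi>\<^sub>1" "smooth_on S \<xi>\<^sub>2"
    and ck: "ck \<psi>\<^sub>1 \<xi>\<^sub>1" "ck \<psi>\<^sub>2 \<xi>\<^sub>2" and dim: "2 \<le> DIM('e)"
    and ein: "\<forall>x\<in>S. \<forall>v w. ricci G x v w = a * G x v w"
  shows "ck (lie_deriv \<xi>\<^sub>1 \<psi>\<^sub>2) (lie_bracket \<xi>\<^sub>1 \<xi>\<^sub>2)"
  unfolding ck_def
proof (intro ballI allI)
  fix x Y v assume x: "x \<in> S"
  let ?h = "lie_deriv \<xi>\<^sub>1 G" and ?C = "lie_conn \<xi>\<^sub>1 x"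
  note \<psi>2 = form_field(1)[OF form(2)]
  have \<psi>2x: "bilinear (\<psi>\<^sub>2 x)" using \<psi>2 x by (simp add: bilinear_field_def)
  have einx: "\<And>v w. ricci G x v w = a * G x v w" if "x \<in> S" for x using ein that by blast
  have "(\<forall>u v. ?h x u v = 0) \<and> (\<forall>u v. ?C u v = 0) \<or>
    DIM('e) = 2 \<and> (\<forall>E. inner_form.onb (G x) E \<longrightarrow>
      (\<Sum>e\<in>E. ?h x e e) = 0 \<and> (\<forall>u. (\<Sum>e\<in>E. G x (?C u e) e) = 0))"
  proof (cases "DIM('e) = 2")
    case True
    have h: "(\<Sum>e\<in>E. lie_deriv \<xi>\<^sub>1 G x e e) = 0" if "x \<in> S" "inner_form.onb (G x) E" for x E
      using ck_divergence_free[OF form(1) \<xi>(1) ck(1) that(1) einx[OF that(1)] dim that(2)]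
      by (simp add: lie_metric[OF that(1)] G_sym[OF that(1), of _ "nabla_vec _ _ _ _"] sum_distrib_left[symmetric])
    show ?thesis
      using True h[OF x] lie_conn_traceless[OF \<xi>(1) True h x] by blast
  next
    case False
    then have "2 < DIM('e)" using dim by simp
    then have h: "lie_deriv \<xi>\<^sub>1 G x u v = 0" if "x \<in> S" for x u v
      by (rule ck_killing[OF form(1) \<xi>(1) ck(1) that einx[OF that]])
    show ?thesis using h[OF x] lie_conn_killing[OF \<xi>(1) h x] by blast
  qed
  then consider (killing) "\<And>u v. ?h x u v = 0" "\<And>u v. ?C u v = 0"
    | (surface) "DIM('e) = 2" "(\<Sum>e\<in>unit_frame x ` Basis. ?h x e e) = 0"
        "\<And>u. (\<Sum>e\<in>unit_frame x ` Basis. G x (?C u e) e) = 0"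
    using unit_frame_onb[OF x] by blast
  note alternatives = this
  have conn: "\<psi>\<^sub>2 x (?C Y Y) v + \<psi>\<^sub>2 x Y (?C Y v) = 0"
  proof (cases rule: alternatives)
    case killing
    then show ?thesis by (simp add: bilinear_simps[OF \<psi>2x])
  next
    case surface
    show ?thesis
      by (rule inner_form.traceless_kills_forms[OF inner_form[OF x] unit_frame_onb[OF x] surface(1)
            lie_conn_linear[OF \<xi>(1) x] surface(3) \<psi>2x form_field(2)[OF form(2) x]])
  qed
  have metric: "?h x Y Y * G x (\<xi>\<^sub>2 x) v + G x Y Y * ?h x (\<xi>\<^sub>2 x) v
      - ?h x Y v * G x (\<xi>\<^sub>2 x) Y - G x Y v * ?h x (\<xi>\<^sub>2 x) Y = 0"
  proof (cases rule: alternatives)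
    case killing
    then show ?thesis by simp
  next
    case surface
    have b: "bilinear (?h x)"
      using lie_deriv_field[OF S G_field \<xi>(1)] x by (simp add: bilinear_field_def)
    from inner_form.traceless_symmetric_dim2(1)[OF inner_form[OF x] unit_frame_onb[OF x] surface(1,2)
        b lie_metric_sym[OF x], of Y "\<xi>\<^sub>2 x" v]
    show ?thesis
      unfolding G_sym[OF x, of Y "\<xi>\<^sub>2 x"] lie_metric_sym[OF x, of \<xi>\<^sub>1 Y "\<xi>\<^sub>2 x"] by simp
  qed
  define c where "c = - (1 / (real DIM('e) - 1))"
  let ?K = "D \<xi>\<^sub>1 x" and ?G = "G x" and ?k = "\<xi>\<^sub>1 x" and ?z = "\<xi>\<^sub>2 x"
  note D1 = D_ck[OF \<xi>(2) ck(2) x, of Y v ?k, folded c_def]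
  have ck': "nabla_form G Y \<psi>\<^sub>2 x Y w = c * (?G Y Y * ?G ?z w - ?G Y w * ?G ?z Y)" for w
    using ck(2) x by (simp add: ck_def c_def)
  note pol = ck_polar[OF \<psi>2 ck(2) x, of "?K Y" Y v, folded c_def]
  \<comment> \<open>Metric derivatives along \<open>\<xi>\<^sub>1\<close> are traded for
    \<open>?h\<close> and terms in \<open>?K\<close>. The term in \<open>?K ?z\<close> joins the
    derivative of \<open>\<xi>\<^sub>2\<close> along \<open>\<xi>\<^sub>1\<close> to form the
    bracket, the other \<open>?K\<close> terms cancel, and the \<open>?h\<close> terms add up to
    \<open>metric\<close>.\<close>
  have lie: "D (\<lambda>y. G y u w) x ?k = ?h x u w - ?G (?K u) w - ?G u (?K w)" for u w
    by (simp add: lie_deriv_eq[where b = G, OF G_bil[OF x]])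
  have "nabla_form G Y (lie_deriv \<xi>\<^sub>1 \<psi>\<^sub>2) x Y v =
      D (\<lambda>y. nabla_form G Y \<psi>\<^sub>2 y Y v) x ?k + (nabla_form G (?K Y) \<psi>\<^sub>2 x Y v
      + nabla_form G Y \<psi>\<^sub>2 x (?K Y) v) + nabla_form G Y \<psi>\<^sub>2 x Y (?K v)"
    using nabla_lie_deriv[OF \<psi>2 \<xi>(1) x, of Y Y v] conn by simp
  also have "\<dots> = c * (?G Y Y * ?G (lie_bracket \<xi>\<^sub>1 \<xi>\<^sub>2 x) v - ?G Y v * ?G (lie_bracket \<xi>\<^sub>1 \<xi>\<^sub>2 x) Y)
    + c * (?h x Y Y * ?G ?z v + ?G Y Y * ?h x ?z v - ?h x Y v * ?G ?z Y - ?G Y v * ?h x ?z Y)"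
    unfolding D1 pol ck' lie lie_bracket_def
    by (simp add: bilinear_simps[OF G_bil[OF x]] G_sym[OF x, of Y "?K Y"] algebra_simps)
  finally show "nabla_form G Y (lie_deriv \<xi>\<^sub>1 \<psi>\<^sub>2) x Y v = - (1 / (real DIM('e) - 1)) *
      (?G Y Y * ?G (lie_bracket \<xi>\<^sub>1 \<xi>\<^sub>2 x) v - ?G Y v * ?G (lie_bracket \<xi>\<^sub>1 \<xi>\<^sub>2 x) Y)"
    unfolding metric c_def by simp
qed

section \<open>The bracket of two conformal-Killing forms\<close>

lemma lie_deriv_form:
  assumes form: "form_field \<psi>" and K: "smooth_on S K"
  shows "form_field (lie_deriv K \<psi>)"
proof -
  note \<psi> = form_field(1)[OF form] and alt = form_field(2)[OF form]
  have "lie_deriv K \<psi> x u v = - lie_deriv K \<psi> x v u" if x: "x \<in> S" for x u v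
  proof -
    have bx: "bilinear (\<psi> x)" using \<psi> x by (simp add: bilinear_field_def)
    have "D (\<lambda>y. \<psi> y u v) x (K x) = D (\<lambda>y. - \<psi> y v u) x (K x)"
      by (rule fun_cong[OF D_cong[OF S x]]) (rule alt)
    also have "\<dots> = - D (\<lambda>y. \<psi> y v u) x (K x)"
      using \<psi> by (intro D_minus smooth_on_differentiable[OF S _ x]) (simp add: bilinear_field_def)
    finally show ?thesis
      unfolding lie_deriv_eq[where b = \<psi>, OF bx]
      using alt[OF x, of "D K x u" v] alt[OF x, of u "D K x v"] by simp
  qed
  with lie_deriv_field[OF S \<psi> K] show ?thesis unfolding form_field_def by blast
qed

lemma form_field_half_diff:
  assumes "form_field a" "form_field b"
  shows "form_field (\<lambda>x u v. 1 / 2 * (a x u v - b x u v))"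
proof -
  have "bilinear_field S (\<lambda>x u v. 1 / 2 * (a x u v - b x u v))"
  proof -
    have d: "bilinear_field S (\<lambda>x u v. a x u v - b x u v)"
      using assms by (intro bilinear_field_diff S) (auto simp: form_field_def)
    have "linear (\<lambda>u. 1 / 2 * f u)" if "linear f" for f :: "'e \<Rightarrow> real"
      using linear_compose_scale_right[OF that, of "1/2"] by simp
    with d show ?thesis
      by (auto simp: bilinear_field_def bilinear_def intro!: smooth_on_divide S smooth_on_const)
  qed
  moreover have "1 / 2 * (a x u v - b x u v) = - (1 / 2 * (a x v u - b x v u))" if "x \<in> S" for x u v
    using form_field(2)[OF assms(1) that, of u v] form_field(2)[OF assms(2) that, of u v] by (simp add: field_simps)
  ultimately show ?thesis unfolding form_field_def by blast
qed

lemma nabla_form_half_diff: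
  assumes a: "bilinear_field S a" and b: "bilinear_field S b" and x: "x \<in> S"
  shows "nabla_form G Y (\<lambda>x u v. 1 / 2 * (a x u v - b x u v)) x u v =
    1 / 2 * (nabla_form G Y a x u v - nabla_form G Y b x u v)"
proof -
  have d: "(\<lambda>y. a y u v) differentiable (at x)" "(\<lambda>y. b y u v) differentiable (at x)"
    using a b by (auto intro!: smooth_on_differentiable[OF S _ x] simp: bilinear_field_def)
  have "D (\<lambda>y. 1 / 2 * (a y u v - b y u v)) x Y = 1 / 2 * D (\<lambda>y. a y u v - b y u v) x Y"
    by (rule D_cmult) (intro differentiable_diff d)
  then show ?thesis
    unfolding nabla_form_eq by (simp add: D_diff[OF d] algebra_simps)
qed

text \<open>Exchanging the two forms reverses the sign of the vector field bracket, so the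
  difference yields it twice; this is the reason for the factor 1/2.\<close>

lemma bracket_ck:
  assumes form: "form_field \<psi>\<^sub>1" "form_field \<psi>\<^sub>2" and \<xi>: "smooth_on S \<xi>\<^sub>1" "smooth_on S \<xi>\<^sub>2"
    and ck: "ck \<psi>\<^sub>1 \<xi>\<^sub>1" "ck \<psi>\<^sub>2 \<xi>\<^sub>2" and dim: "2 \<le> DIM('e)"
    and ein: "\<forall>x\<in>S. \<forall>v w. ricci G x v w = a * G x v w"
  shows "ck (\<lambda>x u v. 1 / 2 * (lie_deriv \<xi>\<^sub>1 \<psi>\<^sub>2 x u v - lie_deriv \<xi>\<^sub>2 \<psi>\<^sub>1 x u v)) (lie_bracket \<xi>\<^sub>1 \<xi>\<^sub>2)"
  unfolding ck_def
proof (intro ballI allI)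
  fix x Y v assume x: "x \<in> S"
  define c where "c = - (1 / (real DIM('e) - 1))"
  have 1: "nabla_form G Y (lie_deriv \<xi>\<^sub>1 \<psi>\<^sub>2) x Y v = c *
      (G x Y Y * G x (lie_bracket \<xi>\<^sub>1 \<xi>\<^sub>2 x) v - G x Y v * G x (lie_bracket \<xi>\<^sub>1 \<xi>\<^sub>2 x) Y)"
    using lie_deriv_ck[OF form \<xi> ck dim ein] x by (simp add: ck_def c_def)
  have anti: "lie_bracket \<xi>\<^sub>2 \<xi>\<^sub>1 x = - lie_bracket \<xi>\<^sub>1 \<xi>\<^sub>2 x" by (simp add: lie_bracket_def)
  have 2: "nabla_form G Y (lie_deriv \<xi>\<^sub>2 \<psi>\<^sub>1) x Y v = c *
      (G x Y Y * G x (lie_bracket \<xi>\<^sub>2 \<xi>\<^sub>1 x) v - G x Y v * G x (lie_bracket \<xi>\<^sub>2 \<xi>\<^sub>1 x) Y)"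
    using lie_deriv_ck[OF form(2,1) \<xi>(2,1) ck(2,1) dim ein] x by (simp add: ck_def c_def)
  show "nabla_form G Y (\<lambda>x u v. 1 / 2 * (lie_deriv \<xi>\<^sub>1 \<psi>\<^sub>2 x u v - lie_deriv \<xi>\<^sub>2 \<psi>\<^sub>1 x u v)) x Y v
     = - (1 / (real DIM('e) - 1)) *
      (G x Y Y * G x (lie_bracket \<xi>\<^sub>1 \<xi>\<^sub>2 x) v - G x Y v * G x (lie_bracket \<xi>\<^sub>1 \<xi>\<^sub>2 x) Y)"
    unfolding nabla_form_half_diff[OF lie_deriv_field[OF S form_field(1)[OF form(2)] \<xi>(1)]
        lie_deriv_field[OF S form_field(1)[OF form(1)] \<xi>(2)] x] 1 2 anti c_def[symmetric]
    by (simp add: bilinear_simps[OF G_bil[OF x]] algebra_simps)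
qed

subsection \<open>The conformal-Killing equation and its diagonal\<close>

text \<open>The connection terms cancel in pairs by symmetry of \<open>\<Gamma>\<close> and
  antisymmetry of the form.\<close>

lemma ext_deriv_nabla:
  assumes form: "form_field \<psi>" and x: "x \<in> S"
  shows "ext_deriv \<psi> x y u v = nabla_form G y \<psi> x u v + nabla_form G u \<psi> x v y + nabla_form G v \<psi> x y u"
  unfolding ext_deriv_def nabla_form_eq
  using form_field(2)[OF form x, of "\<Gamma> x y u" v] form_field(2)[OF form x, of "\<Gamma> x u v" y]
    form_field(2)[OF form x, of "\<Gamma> x v y" u] \<Gamma>_sym[OF x, of y u] \<Gamma>_sym[OF x, of u v] \<Gamma>_sym[OF x, of v y]
  by simp

text \<open>By \<open>ck_polar\<close> the other two cyclic terms of the exterior derivative equal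
  the first up to metric terms. Altogether d psi is three times nabla psi plus 3/(m - 1) times the
  wedge term.\<close>

lemma ck_imp_conformal:
  assumes form: "form_field \<psi>" and ck: "ck \<psi> \<xi>" and x: "x \<in> S"
  shows "nabla_form G y \<psi> x u v = 1 / 3 * ext_deriv \<psi> x y u v
    - 1 / (real DIM('e) - 1) * wedge G x y (\<xi> x) u v"
proof -
  note pol = ck_polar[OF form_field(1)[OF form] ck x] and alt = nabla_form_alt[OF form x]
  define c where "c = 1 / (real DIM('e) - 1)"
  have 1: "nabla_form G u \<psi> x v y = nabla_form G y \<psi> x u v
      + c * (2 * G x y u * G x (\<xi> x) v - G x y v * G x (\<xi> x) u - G x u v * G x (\<xi> x) y)"
    using pol[of y u v] alt[of u v y] by (simp add: c_def)
  have 2: "nabla_form G v \<psi> x y u = nabla_form G y \<psi> x u v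
      - c * (2 * G x y v * G x (\<xi> x) u - G x y u * G x (\<xi> x) v - G x v u * G x (\<xi> x) y)"
    using pol[of y v u] alt[of y v u] by (simp add: c_def)
  show ?thesis
    unfolding ext_deriv_nabla[OF form x] 1 2 wedge_def c_def[symmetric]
    by (simp add: G_sym[OF x, of v u] algebra_simps)
qed

lemma orthonormal_basis_iff: "x \<in> S \<Longrightarrow> orthonormal_basis G x E \<longleftrightarrow> inner_form.onb (G x) E"
  by (simp add: orthonormal_basis_def inner_form.onb_def[OF inner_form])

text \<open>Uniqueness in the definite description rests on the existence of at least one
  orthonormal basis at \<open>x\<close>, supplied by \<open>unit_frame_onb\<close>.\<close>

lemma codiff_eqI:
  assumes x: "x \<in> S"
    and d: "\<And>E v. inner_form.onb (G x) E \<Longrightarrow> G x d v = - (\<Sum>e\<in>E. nabla_form G e \<psi> x e v)"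
  shows "codiff G \<psi> x = d"
  unfolding codiff_def orthonormal_basis_iff[OF x]
proof (rule the_equality)
  show "\<forall>E. inner_form.onb (G x) E \<longrightarrow> (\<forall>v. G x d v = - (\<Sum>e\<in>E. nabla_form G e \<psi> x e v))"
    using d by blast
  fix d' assume "\<forall>E. inner_form.onb (G x) E \<longrightarrow> (\<forall>v. G x d' v = - (\<Sum>e\<in>E. nabla_form G e \<psi> x e v))"
  then have "G x d' v = G x d v" for v
    using d[OF unit_frame_onb[OF x]] unit_frame_onb[OF x] by simp
  then show "d' = d" by (rule inner_form.nondegenerate[OF inner_form[OF x]])
qed

lemma ck_codiff:
  assumes ck: "ck \<psi> \<xi>" and dim: "2 \<le> DIM('e)" and x: "x \<in> S"
  shows "codiff G \<psi> x = \<xi> x"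
proof (rule codiff_eqI[OF x])
  interpret inner_form "G x" by (rule inner_form[OF x])
  fix E v assume E: "onb E"
  define c where "c = 1 / (real DIM('e) - 1)"
  have c: "c * (real DIM('e) - 1) = 1" using dim by (simp add: c_def)
  have "- (\<Sum>e\<in>E. nabla_form G e \<psi> x e v)
      = - (\<Sum>e\<in>E. - c * (G x e e * G x (\<xi> x) v - G x (\<xi> x) e * G x e v))"
    using ck x by (simp add: ck_def c_def mult.commute)
  also have "\<dots> = c * ((\<Sum>e\<in>E. G x e e) * G x (\<xi> x) v - (\<Sum>e\<in>E. G x (\<xi> x) e * G x e v))"
    by (simp add: sum_distrib_left[symmetric] sum_negf sum_subtractf sum_distrib_right)
  also have "\<dots> = (c * (real DIM('e) - 1)) * G x (\<xi> x) v"
    by (simp only: onb_card[OF E] onb_inner[OF E]) (simp add: algebra_simps)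
  finally show "G x (\<xi> x) v = - (\<Sum>e\<in>E. nabla_form G e \<psi> x e v)" by (simp add: c)
qed

text \<open>For dimension one, where all 2-forms vanish. Vanishing is assumed on all of
  \<open>S\<close>, since derivatives are taken.\<close>

lemma zero_form:
  assumes z: "\<And>x u v. x \<in> S \<Longrightarrow> \<psi> x u v = 0" and x: "x \<in> S"
  shows "nabla_form G Y \<psi> x u v = 0" "ext_deriv \<psi> x u v w = 0" "lie_deriv K \<psi> x u v = 0"
    "codiff G \<psi> x = 0"
proof -
  have d: "D (\<lambda>y. \<psi> y u v) x w = 0" for u v w
  proof -
    have "D (\<lambda>y. \<psi> y u v) x w = D (\<lambda>y. 0) x w"
      by (rule fun_cong[OF D_cong[OF S x]]) (rule z)
    then show ?thesis by simp
  qed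
  show n: "nabla_form G Y \<psi> x u v = 0" for Y u v by (simp add: nabla_form_def d z[OF x])
  show "ext_deriv \<psi> x u v w = 0" by (simp add: ext_deriv_def d)
  show "lie_deriv K \<psi> x u v = 0" by (simp add: lie_deriv_def d z[OF x])
  show "codiff G \<psi> x = 0"
    by (rule codiff_eqI[OF x]) (simp add: n bilinear_simps[OF G_bil[OF x]])
qed

lemma conformal_imp_ck:
  assumes form: "form_field \<psi>"
    and eq: "\<And>x y u v. x \<in> S \<Longrightarrow> nabla_form G y \<psi> x u v = 1 / 3 * ext_deriv \<psi> x y u v
      - 1 / (real DIM('e) - 1) * wedge G x y (\<xi> x) u v"
  shows "ck \<psi> \<xi>"
  unfolding ck_def
proof (intro ballI allI)
  fix x Y v assume x: "x \<in> S"
  note alt = nabla_form_alt[OF form x]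
  have "ext_deriv \<psi> x Y Y v = 0"
    unfolding ext_deriv_nabla[OF form x] using alt[of Y Y v] alt[of v Y Y] by simp
  then show "nabla_form G Y \<psi> x Y v =
     - (1 / (real DIM('e) - 1)) * (G x Y Y * G x (\<xi> x) v - G x Y v * G x (\<xi> x) Y)"
    unfolding eq[OF x] wedge_def by simp
qed

section \<open>Smoothness and uniqueness of the vector field in the diagonal equation\<close>

lemma gram_pos:
  assumes x: "x \<in> S" and v: "v \<noteq> 0" and Y: "Y \<notin> span {v}"
  shows "G x Y Y * G x v v - G x Y v * G x Y v > 0"
proof -
  interpret inner_form "G x" by (rule inner_form[OF x])
  \<comment> \<open>The component of \<open>Y\<close> orthogonal to \<open>v\<close>, scaled by
    \<open>G x v v\<close> to avoid division; its squared length is \<open>G x v v\<close> times the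
    Gram determinant.\<close>
  define w where "w = G x v v *\<^sub>R Y - G x Y v *\<^sub>R v"
  have vv: "G x v v > 0" using pos v .
  have "w \<noteq> 0"
  proof
    assume "w = 0"
    then have "(1 / G x v v) *\<^sub>R (G x v v *\<^sub>R Y) = (1 / G x v v) *\<^sub>R (G x Y v *\<^sub>R v)" by (simp add: w_def)
    then have "Y = (G x Y v / G x v v) *\<^sub>R v" using vv by simp
    then show False using Y span_scale[OF span_base[of v "{v}"]] by (metis singletonI)
  qed
  then have "0 < G x w w" by (rule pos)
  also have "G x w w = G x v v * (G x Y Y * G x v v - G x Y v * G x Y v)"
    by (simp add: w_def g_simps sym[of v Y] algebra_simps)
  finally show ?thesis using vv by (simp add: zero_less_mult_iff)
qed

lemma exists_not_in_span:
  assumes "2 \<le> DIM('e)"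
  shows "\<exists>Y. Y \<notin> span {v :: 'e}"
proof (rule ccontr)
  assume "\<not> (\<exists>Y. Y \<notin> span {v})"
  then have "(UNIV :: 'e set) \<subseteq> span {v}" by blast
  then have "dim (UNIV :: 'e set) \<le> card {v}" by (rule dim_le_card) simp
  then show False using assms by simp
qed

text \<open>
  Two instances of the diagonal equation, for \<open>Y, Y, v\<close> and \<open>v, v, Y\<close>, form a linear system for
  the values of the dual form of \<open>\<xi>\<close> at \<open>Y\<close> and \<open>v\<close>.
\<close>

lemma ck_smooth:
  assumes \<psi>: "bilinear_field S \<psi>" and ck: "ck \<psi> \<xi>" and dim: "2 \<le> DIM('e)"
  shows "smooth_on S \<xi>"
proof -
  have smG: "smooth_on S (\<lambda>y. G y u w)" for u w
    using G_field by (auto simp: bilinear_field_def)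
  have smN: "smooth_on S (\<lambda>y. nabla_form G Y \<psi> y u w)" for Y u w
    using nabla_form_field[OF \<psi>] by (auto simp: bilinear_field_def)
  have "smooth_on S (\<lambda>x. G x (\<xi> x) v)" for v
  proof (cases "v = 0")
    case True
    show ?thesis
      by (rule smooth_on_cong[OF S _ smooth_on_const[of S 0]]) (simp add: True bilinear_simps[OF G_bil])
  next
    case False
    \<comment> \<open>Independence of \<open>Y\<close> and \<open>v\<close> does not depend on the
      point, so a single quotient, given by Cramer's rule with the Gram determinant as denominator,
      serves on all of \<open>S\<close>.\<close>
    obtain Y where Y: "Y \<notin> span {v}" using exists_not_in_span[OF dim] by blast
    let ?d = "\<lambda>x. G x Y Y * G x v v - G x Y v * G x Y v"
    let ?n = "\<lambda>x. G x v v * nabla_form G Y \<psi> x Y v + G x Y v * nabla_form G v \<psi> x v Y"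
    show ?thesis
    proof (rule smooth_on_cong[OF S])
      show "smooth_on S (\<lambda>x. (- (real DIM('e) - 1) * ?n x) / ?d x)"
        using gram_pos[OF _ False Y] by (intro smooth_on_divide smooth_intros S smG smN) fastforce+
      fix x assume x: "x \<in> S"
      define c where "c = 1 / (real DIM('e) - 1)"
      have c: "(real DIM('e) - 1) * c = 1" using dim by (simp add: c_def)
      have N: "nabla_form G Y \<psi> x Y v = - c * (G x Y Y * G x (\<xi> x) v - G x Y v * G x (\<xi> x) Y)"
        "nabla_form G v \<psi> x v Y = - c * (G x v v * G x (\<xi> x) Y - G x v Y * G x (\<xi> x) v)"
        using ck x by (auto simp: ck_def c_def)
      have "- (real DIM('e) - 1) * ?n x = ((real DIM('e) - 1) * c) * (?d x * G x (\<xi> x) v)"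
        unfolding N by (simp add: G_sym[OF x, of v Y] algebra_simps)
      then show "(- (real DIM('e) - 1) * ?n x) / ?d x = G x (\<xi> x) v"
        unfolding c using gram_pos[OF x False Y] by simp
    qed
  qed
  then have "linear_field S (\<lambda>x v. G x (\<xi> x) v)"
    using G_bil by (auto simp: linear_field_def bilinear_def)
  from riesz[OF this] obtain V where V: "smooth_on S V"
    "\<And>x v. x \<in> S \<Longrightarrow> G x (V x) v = G x (\<xi> x) v" by blast
  then have "V x = \<xi> x" if "x \<in> S" for x
    using that by (intro inner_form.nondegenerate[OF inner_form[OF that]]) auto
  with V(1) show ?thesis using smooth_on_cong[OF S] by blast
qed

text \<open>Taking \<open>v\<close> to be the difference of the two vectors turns the equation into
  the vanishing of a Gram determinant.\<close>

lemma ck_unique: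
  assumes x: "x \<in> S" and dim: "2 \<le> DIM('e)"
    and eq: "\<And>Y v. G x Y Y * G x d v - G x Y v * G x d Y = G x Y Y * G x d' v - G x Y v * G x d' Y"
  shows "d = d'"
proof (rule ccontr)
  interpret inner_form "G x" by (rule inner_form[OF x])
  assume "d \<noteq> d'"
  then have z: "d - d' \<noteq> 0" by simp
  obtain Y where Y: "Y \<notin> span {d - d'}" using exists_not_in_span[OF dim] by blast
  define z where "z = d - d'"
  have "G x Y Y * G x z z - G x Y z * G x z Y = 0"
    using eq[of Y z] by (simp add: g_simps z_def algebra_simps)
  with gram_pos[OF x z Y] show False
    unfolding z_def[symmetric] by (simp add: sym[of z Y])
qed

end

subsection \<open>Naturality under changes of charts\<close>

locale local_isometry = src: metric_field S G + tgt: metric_field S' G'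
  for S :: "'e::euclidean_space set" and G and S' :: "'e set" and G' +
  fixes U :: "'e set" and t :: "'e \<Rightarrow> 'e"
  assumes U: "open U" "U \<subseteq> S" and t_smooth: "smooth_on U t" and t_im: "t ` U \<subseteq> S'"
    and G_pull: "x \<in> U \<Longrightarrow> G x u v = G' (t x) (D t x u) (D t x v)"
begin

text \<open>The inhomogeneous term in the transformation law of Christoffel symbols.\<close>

definition hess :: "'e \<Rightarrow> 'e \<Rightarrow> 'e \<Rightarrow> 'e" where
  "hess x u v = D (\<lambda>y. D t y v) x u"

lemma hess_sym: "x \<in> U \<Longrightarrow> hess x u v = hess x v u"
  unfolding hess_def by (rule D_commute[OF U(1) t_smooth])

lemma hess_bilinear: "x \<in> U \<Longrightarrow> bilinear (hess x)"
  using linear_field_D_arg[OF U(1) linear_field_D[OF U(1) t_smooth]]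
    linear_field_D[OF U(1) smooth_on_D[OF t_smooth]]
  by (auto simp: bilinear_def hess_def linear_field_def)

lemma t_diff: "x \<in> U \<Longrightarrow> t differentiable (at x)"
  by (rule smooth_on_differentiable[OF U(1) t_smooth])

lemma jac_linear: "x \<in> U \<Longrightarrow> linear (D t x)"
  by (rule D_linear[OF t_diff])

lemma in_S: "x \<in> U \<Longrightarrow> x \<in> S" and t_in: "x \<in> U \<Longrightarrow> t x \<in> S'"
  using U t_im by auto

text \<open>A vector killed by the Jacobian would have zero length in the pulled-back metric. Thus
  invertibility comes from \<open>G_pull\<close>, and the inverse transition need not be
  differentiated.\<close>

lemma jac_surj:
  assumes x: "x \<in> U"
  shows "surj (D t x)"
proof (rule linear_inj_imp_surj[OF jac_linear[OF x]])
  show "inj (D t x)"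
    unfolding linear_injective_0[OF jac_linear[OF x]]
  proof (intro allI impI, rule ccontr)
    fix u assume "D t x u = 0" "u \<noteq> 0"
    then show False
      using src.G_pos[OF in_S[OF x], of u] G_pull[OF x, of u u]
      by (simp add: bilinear_simps[OF tgt.G_bil[OF t_in[OF x]]])
  qed
qed

definition related :: "'e local_tensor2 \<Rightarrow> 'e local_tensor2 \<Rightarrow> bool" where
  "related b b' \<longleftrightarrow> (\<forall>x\<in>U. \<forall>u v. b x u v = b' (t x) (D t x u) (D t x v))"

lemma D_related:
  assumes b': "bilinear_field S' b'" and r: "related b b'" and x: "x \<in> U"
  shows "D (\<lambda>y. b y u v) x w = D (\<lambda>z. b' z (D t x u) (D t x v)) (t x) (D t x w)
    + b' (t x) (hess x w u) (D t x v) + b' (t x) (D t x u) (hess x w v)"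
proof -
  have sm': "smooth_on S' (\<lambda>z. b' z p q)" for p q using b' by (simp add: bilinear_field_def)
  have f: "bilinear_field U (\<lambda>y. b' (t y))"
    using b' t_im smooth_on_compose[OF U(1) tgt.S t_smooth t_im sm']
    by (auto simp: bilinear_field_def)
  have "D (\<lambda>y. b y u v) x w = D (\<lambda>y. b' (t y) (D t y u) (D t y v)) x w"
    by (rule fun_cong[OF D_cong[OF U(1) x]]) (use r in \<open>simp add: related_def\<close>)
  also have "\<dots> = D (\<lambda>y. b' (t y) (D t x u) (D t x v)) x w
      + b' (t x) (hess x w u) (D t x v) + b' (t x) (D t x u) (hess x w v)"
    unfolding hess_def
    by (rule D_bilinear_field[OF U(1) f smooth_on_D[OF t_smooth] smooth_on_D[OF t_smooth] x])
  also have "D (\<lambda>y. b' (t y) (D t x u) (D t x v)) x w = D (\<lambda>z. b' z (D t x u) (D t x v)) (t x) (D t x w)"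
    by (rule D_eqI[OF has_derivative_compose[OF D_works[OF t_diff[OF x]]
          D_works[OF smooth_on_differentiable[OF tgt.S sm' t_in[OF x]]]]])
  finally show ?thesis .
qed

text \<open>The right-hand side, pulled back by a right inverse of the Jacobian, satisfies the
  conditions that characterise the connection of the source metric; the Hessian terms are those in
  the derivative of \<open>G_pull\<close>.\<close>

lemma \<Gamma>_related:
  assumes x: "x \<in> U"
  shows "D t x (src.\<Gamma> x u v) = tgt.\<Gamma> (t x) (D t x u) (D t x v) + hess x u v"
proof -
  let ?J = "D t x"
  note J = jac_linear[OF x] and B = tgt.\<Gamma>_bil[OF t_in[OF x]] and H = hess_bilinear[OF x]
    and G'b = bilinear_simps[OF tgt.G_bil[OF t_in[OF x]]]
  obtain I where I: "linear I" "?J \<circ> I = id"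
    using linear_surjective_right_inverse[OF J jac_surj[OF x]] by blast
  have JI: "?J (I z) = z" for z using I(2) by (metis comp_apply id_apply)
  define C where "C u v = I (tgt.\<Gamma> (t x) (?J u) (?J v) + hess x u v)" for u v
  have "src.\<Gamma> x = C"
  proof (rule src.christoffel_eqI[OF in_S[OF x]])
    show "bilinear C"
      unfolding bilinear_def C_def
      by (auto intro!: linearI simp: bilinear_simps[OF B] bilinear_simps[OF H] linear_add[OF J]
          linear_cmul[OF J] linear_add[OF I(1), symmetric] linear_cmul[OF I(1), symmetric] algebra_simps)
    show "C u v = C v u" for u v
      by (simp add: C_def tgt.\<Gamma>_sym[OF t_in[OF x], of "?J u"] hess_sym[OF x, of u])
    have "related G G'" by (simp add: related_def G_pull)
    then show "D (\<lambda>y. G y v w) x u = G x (C u v) w + G x v (C u w)" for u v w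
      by (simp add: D_related[OF tgt.G_field _ x] tgt.\<Gamma>_metric[OF t_in[OF x]] G_pull[OF x] C_def JI G'b)
  qed
  then show ?thesis by (simp add: C_def JI)
qed

lemma nabla_form_related:
  assumes b': "bilinear_field S' b'" and r: "related b b'" and x: "x \<in> U"
  shows "nabla_form G Y b x u v = nabla_form G' (D t x Y) b' (t x) (D t x u) (D t x v)"
proof -
  have "bilinear (b' (t x))" using b' t_in[OF x] by (simp add: bilinear_field_def)
  note bs = bilinear_simps[OF this]
  have "b x p q = b' (t x) (D t x p) (D t x q)" for p q using r x by (simp add: related_def)
  then show ?thesis
    unfolding src.nabla_form_eq tgt.nabla_form_eq D_related[OF b' r x]
    by (simp add: \<Gamma>_related[OF x] bs)
qed

text \<open>The pushed-forward field and \<open>\<xi>'\<close> both satisfy the diagonal equation at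
  \<open>t x\<close>, so \<open>ck_unique\<close> identifies them; the frames in
  \<open>codiff\<close> need not be transformed.\<close>

lemma ck_related:
  assumes b': "bilinear_field S' b'" and r: "related b b'" and ck: "src.ck b \<xi>" "tgt.ck b' \<xi>'"
    and dim: "2 \<le> DIM('e)" and x: "x \<in> U"
  shows "D t x (\<xi> x) = \<xi>' (t x)"
proof (rule tgt.ck_unique[OF t_in[OF x] dim])
  fix Y' v'
  obtain Y v where Y: "Y' = D t x Y" "v' = D t x v"
    using jac_surj[OF x] by (metis surjD)
  have c: "- (1 / (real DIM('e) - 1)) \<noteq> 0" using dim by simp
  have 1: "nabla_form G' Y' b' (t x) Y' v' = - (1 / (real DIM('e) - 1)) *
      (G' (t x) Y' Y' * G' (t x) (D t x (\<xi> x)) v' - G' (t x) Y' v' * G' (t x) (D t x (\<xi> x)) Y')"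
    using ck(1) in_S[OF x] nabla_form_related[OF b' r x, of Y Y v]
    by (simp add: src.ck_def G_pull[OF x] Y)
  have 2: "nabla_form G' Y' b' (t x) Y' v' = - (1 / (real DIM('e) - 1)) *
      (G' (t x) Y' Y' * G' (t x) (\<xi>' (t x)) v' - G' (t x) Y' v' * G' (t x) (\<xi>' (t x)) Y')"
    using ck(2) t_in[OF x] by (simp add: tgt.ck_def)
  show "G' (t x) Y' Y' * G' (t x) (D t x (\<xi> x)) v' - G' (t x) Y' v' * G' (t x) (D t x (\<xi> x)) Y'
    = G' (t x) Y' Y' * G' (t x) (\<xi>' (t x)) v' - G' (t x) Y' v' * G' (t x) (\<xi>' (t x)) Y'"
    using 1 2 c by (metis mult_cancel_left)
qed

lemma lie_deriv_related:
  assumes b: "bilinear_field S b" and b': "bilinear_field S' b'" and r: "related b b'"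
    and K: "smooth_on S K" "smooth_on S' K'" "\<And>x. x \<in> U \<Longrightarrow> D t x (K x) = K' (t x)" and x: "x \<in> U"
  shows "lie_deriv K b x u v = lie_deriv K' b' (t x) (D t x u) (D t x v)"
proof -
  have bx: "bilinear (b x)" "bilinear (b' (t x))"
    using b b' in_S[OF x] t_in[OF x] by (auto simp: bilinear_field_def)
  have KU: "smooth_on U K"
    by (rule smooth_on_subset[OF src.S U K(1)])
  \<comment> \<open>Differentiate the relation between \<open>K\<close> and \<open>K'\<close>. The
    Hessian that appears cancels the one in \<open>D_related\<close>.\<close>
  have JK: "D t x (D K x w) = D K' (t x) (D t x w) - hess x (K x) w" for w
  proof -
    have "D (\<lambda>y. D t y (K y)) x w = D (\<lambda>y. K' (t y)) x w"
      by (rule fun_cong[OF D_cong[OF U(1) x]]) (rule K(3))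
    also have "\<dots> = D K' (t x) (D t x w)"
      by (rule D_eqI[OF has_derivative_compose[OF D_works[OF t_diff[OF x]]
            D_works[OF smooth_on_differentiable[OF tgt.S K(2) t_in[OF x]]]]])
    finally show ?thesis
      unfolding D_linear_field[OF U(1) linear_field_D[OF U(1) t_smooth] KU x]
      using hess_sym[OF x, of "K x" w] by (simp add: hess_def algebra_simps)
  qed
  have "b x p q = b' (t x) (D t x p) (D t x q)" for p q using r x by (simp add: related_def)
  then show ?thesis
    unfolding lie_deriv_eq[where b = b, OF bx(1)] lie_deriv_eq[where b = b', OF bx(2)] D_related[OF b' r x]
    by (simp add: JK K(3)[OF x] bilinear_simps[OF bx(2)])
qed

end

subsection \<open>Charts\<close>

lemma overlap_open:
  assumes M: "smooth_manifold M A" and c: "c \<in> A" "c' \<in> A"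
  shows "open (overlap c c')" "overlap c c' \<subseteq> coord_dom c"
    and "transition c c' ` overlap c c' \<subseteq> coord_dom c'"
proof -
  have o: "openin M (fst c)" "openin M (fst c')" "open (coord_dom c)"
    and h: "homeomorphic_map (subtopology M (fst c)) (top_of_set (coord_dom c)) (snd c)"
    using M c by (auto simp: smooth_manifold_def)
  have top: "topspace (subtopology M (fst c)) = fst c"
    using openin_subset[OF o(1)] by auto
  have inj: "inj_on (snd c) (fst c)"
    using homeomorphic_imp_injective_map[OF h] by (simp only: top)
  have "openin (subtopology M (fst c)) (fst c \<inter> fst c')"
    using o(2) by (simp add: openin_subtopology_Int2)
  then have "openin (top_of_set (coord_dom c)) (overlap c c')"
    using homeomorphic_imp_open_map[OF h] by (simp add: open_map_def overlap_def)
  then show "open (overlap c c')" using o(3) by (simp add: openin_open_eq)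
  show "overlap c c' \<subseteq> coord_dom c" by (auto simp: overlap_def coord_dom_def)
  show "transition c c' ` overlap c c' \<subseteq> coord_dom c'"
    using inj by (auto simp: overlap_def coord_dom_def transition_def)
qed

lemma metric_field_chart:
  assumes "riemannian_manifold M A g" "c \<in> A"
  shows "metric_field (coord_dom c) (g c)"
  using assms
  by unfold_locales
    (auto simp: riemannian_manifold_def smooth_manifold_def riemannian_metric_def tensor2_field_def bilinear_field_def)

lemma local_isometry_transition:
  assumes "riemannian_manifold M A g" "c \<in> A" "c' \<in> A"
  shows "local_isometry (coord_dom c) (g c) (coord_dom c') (g c') (overlap c c') (transition c c')"
proof -
  have M: "smooth_manifold M A" and g: "riemannian_metric A g"
    using assms(1) by (auto simp: riemannian_manifold_def)
  interpret src: metric_field "coord_dom c" "g c" by (rule metric_field_chart[OF assms(1,2)])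
  interpret tgt: metric_field "coord_dom c'" "g c'" by (rule metric_field_chart[OF assms(1,3)])
  show ?thesis
  proof unfold_locales
    show "smooth_on (overlap c c') (transition c c')"
      using M assms by (simp add: smooth_manifold_def)
    show "g c x u v = g c' (transition c c' x) (D (transition c c') x u) (D (transition c c') x v)"
      if "x \<in> overlap c c'" for x u v
      using g assms that unfolding riemannian_metric_def tensor2_field_def by blast
  qed (use overlap_open[OF M assms(2,3)] in auto)
qed

lemma form_field_chart:
  assumes g: "riemannian_manifold M A g" and c: "c \<in> A" and \<psi>: "two_form A \<psi>"
  shows "metric_field.form_field (coord_dom c) (\<psi> c)"
proof -
  interpret metric_field "coord_dom c" "g c" by (rule metric_field_chart[OF g c])
  have b: "bilinear_field (coord_dom c) (\<psi> c)"
    using \<psi> c by (simp add: two_form_def tensor2_field_def bilinear_field_def)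
  have "\<psi> c x u v = - \<psi> c x v u" if x: "x \<in> coord_dom c" for x u v
  proof -
    have z: "\<psi> c x w w = 0" for w using \<psi> c x by (simp add: two_form_def)
    have "bilinear (\<psi> c x)" using b x by (simp add: bilinear_field_def)
    then have "\<psi> c x (u + v) (u + v) = \<psi> c x u u + \<psi> c x v v + (\<psi> c x u v + \<psi> c x v u)"
      by (simp add: bilinear_simps)
    then show ?thesis by (simp add: z)
  qed
  with b show ?thesis unfolding form_field_def by blast
qed

lemma ck_chart:
  assumes g: "riemannian_manifold M A g" and c: "c \<in> A" and \<psi>: "conformal_killing A g \<psi>"
  shows "metric_field.ck (coord_dom c) (g c) (\<psi> c) (codiff (g c) (\<psi> c))"
proof -
  interpret metric_field "coord_dom c" "g c" by (rule metric_field_chart[OF g c])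
  have "form_field (\<psi> c)"
    using form_field_chart[OF g c] \<psi> by (simp add: conformal_killing_def)
  then show ?thesis
    by (rule conformal_imp_ck) (use \<psi> c in \<open>simp add: conformal_killing_def\<close>)
qed

lemma two_form_dim1:
  assumes "two_form A \<psi>" "c \<in> A" "x \<in> coord_dom c" "DIM('e) = 1"
  shows "\<psi> c x u (v :: 'e::euclidean_space) = 0"
proof -
  have b: "bilinear (\<psi> c x)" and z: "\<psi> c x w w = 0" for w
    using assms by (auto simp: two_form_def tensor2_field_def)
  obtain b where B: "(Basis :: 'e set) = {b}" using assms(4) by (auto simp: card_1_singleton_iff)
  have e: "w = (w \<bullet> b) *\<^sub>R b" for w :: 'e
    using euclidean_representation[of w] by (simp add: B)
  show ?thesis
    by (subst e[of u], subst e[of v]) (simp add: bilinear_simps[OF b] z)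
qed

lemma form_bracket_eq:
  "form_bracket g \<psi>\<^sub>1 \<psi>\<^sub>2 c = (\<lambda>x u v. 1 / 2 *
    (lie_deriv (codiff (g c) (\<psi>\<^sub>1 c)) (\<psi>\<^sub>2 c) x u v - lie_deriv (codiff (g c) (\<psi>\<^sub>2 c)) (\<psi>\<^sub>1 c) x u v))"
  by (intro ext) (simp add: form_bracket_def)

text \<open>The transformation law holds because the codifferentials correspond under transition
  maps and Lie derivatives along corresponding fields are natural.\<close>

lemma two_form_form_bracket:
  fixes A :: "('p, 'e::euclidean_space) chart set"
  assumes g: "riemannian_manifold M A g" and dim: "2 \<le> DIM('e)"
    and ck: "conformal_killing A g \<psi>\<^sub>1" "conformal_killing A g \<psi>\<^sub>2"
  shows "two_form A (form_bracket g \<psi>\<^sub>1 \<psi>\<^sub>2)"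
proof -
  let ?\<phi> = "form_bracket g \<psi>\<^sub>1 \<psi>\<^sub>2" and ?\<xi> = "\<lambda>\<psi> c. codiff (g c) (\<psi> c)"
  have form: "metric_field.form_field (coord_dom c) (\<psi>\<^sub>1 c)" "metric_field.form_field (coord_dom c) (\<psi>\<^sub>2 c)"
    if "c \<in> A" for c
    using ck form_field_chart[OF g that] by (auto simp: conformal_killing_def)
  have sm: "smooth_on (coord_dom c) (?\<xi> \<psi>\<^sub>1 c)" "smooth_on (coord_dom c) (?\<xi> \<psi>\<^sub>2 c)" if c: "c \<in> A" for c
  proof -
    interpret metric_field "coord_dom c" "g c" by (rule metric_field_chart[OF g c])
    show "smooth_on (coord_dom c) (?\<xi> \<psi>\<^sub>1 c)" "smooth_on (coord_dom c) (?\<xi> \<psi>\<^sub>2 c)"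
      using ck_smooth[OF form_field(1)[OF form(1)[OF c]] ck_chart[OF g c ck(1)] dim]
        ck_smooth[OF form_field(1)[OF form(2)[OF c]] ck_chart[OF g c ck(2)] dim] by auto
  qed
  have \<phi>: "bilinear_field (coord_dom c) (?\<phi> c)"
    "\<And>x u v. x \<in> coord_dom c \<Longrightarrow> ?\<phi> c x u v = - ?\<phi> c x v u" if c: "c \<in> A" for c
  proof -
    interpret metric_field "coord_dom c" "g c" by (rule metric_field_chart[OF g c])
    have "form_field (?\<phi> c)"
      unfolding form_bracket_eq
      by (intro form_field_half_diff lie_deriv_form form[OF c] sm[OF c])
    then show "bilinear_field (coord_dom c) (?\<phi> c)"
      "\<And>x u v. x \<in> coord_dom c \<Longrightarrow> ?\<phi> c x u v = - ?\<phi> c x v u"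
      using form_field by blast+
  qed
  have "?\<phi> c x u v = ?\<phi> c' (transition c c' x) (D (transition c c') x u) (D (transition c c') x v)"
    if c: "c \<in> A" "c' \<in> A" and x: "x \<in> overlap c c'" for c c' x u v
  proof -
    interpret local_isometry "coord_dom c" "g c" "coord_dom c'" "g c'" "overlap c c'" "transition c c'"
      by (rule local_isometry_transition[OF g c])
    have b: "bilinear_field (coord_dom d) (\<psi>\<^sub>1 d)" "bilinear_field (coord_dom d) (\<psi>\<^sub>2 d)" if "d \<in> A" for d
      using ck that by (auto simp: conformal_killing_def two_form_def tensor2_field_def bilinear_field_def)
    have r: "related (\<psi>\<^sub>1 c) (\<psi>\<^sub>1 c')" "related (\<psi>\<^sub>2 c) (\<psi>\<^sub>2 c')"
      using ck c by (simp_all add: related_def conformal_killing_def two_form_def tensor2_field_def)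
    have k: "D (transition c c') x (?\<xi> \<psi>\<^sub>1 c x) = ?\<xi> \<psi>\<^sub>1 c' (transition c c' x)"
      "D (transition c c') x (?\<xi> \<psi>\<^sub>2 c x) = ?\<xi> \<psi>\<^sub>2 c' (transition c c' x)"
      if "x \<in> overlap c c'" for x
      by (rule ck_related[OF b(1)[OF c(2)] r(1) ck_chart[OF g c(1) ck(1)] ck_chart[OF g c(2) ck(1)] dim that])
        (rule ck_related[OF b(2)[OF c(2)] r(2) ck_chart[OF g c(1) ck(2)] ck_chart[OF g c(2) ck(2)] dim that])
    show ?thesis
      unfolding form_bracket_eq
      using lie_deriv_related[OF b(2)[OF c(1)] b(2)[OF c(2)] r(2) sm(1)[OF c(1)] sm(1)[OF c(2)] k(1) x]
        lie_deriv_related[OF b(1)[OF c(1)] b(1)[OF c(2)] r(1) sm(2)[OF c(1)] sm(2)[OF c(2)] k(2) x]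
      by simp
  qed
  then have "tensor2_field A ?\<phi>"
    using \<phi>(1) by (simp add: tensor2_field_def bilinear_field_def)
  moreover have "?\<phi> c x u u = 0" if "c \<in> A" "x \<in> coord_dom c" for c x u
    using \<phi>(2)[OF that, of u u] by simp
  ultimately show ?thesis by (simp add: two_form_def)
qed

theorem proposition11:
  fixes M :: "'p topology"
    and A :: "('p, 'e::euclidean_space) chart set"
    and g \<psi>\<^sub>1 \<psi>\<^sub>2 :: "('p, 'e) tensor2"
  assumes "riemannian_manifold M A g"
    and "einstein A g"
    and "conformal_killing A g \<psi>\<^sub>1"
    and "conformal_killing A g \<psi>\<^sub>2"
  shows "conformal_killing A g (form_bracket g \<psi>\<^sub>1 \<psi>\<^sub>2) \<and>
    (\<forall>c\<in>A. \<forall>x\<in>coord_dom c.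
       codiff (g c) (form_bracket g \<psi>\<^sub>1 \<psi>\<^sub>2 c) x =
       lie_bracket (codiff (g c) (\<psi>\<^sub>1 c)) (codiff (g c) (\<psi>\<^sub>2 c)) x)"
proof (cases "DIM('e) = 1")
  \<comment> \<open>Here 1 / (m - 1) is 1 / 0 = 0, so the diagonal equation carries no information
    on the vector field; but every 2-form, and with it every term of both claims, is zero.\<close>
  case True
  let ?\<phi> = "form_bracket g \<psi>\<^sub>1 \<psi>\<^sub>2"
  have z: "\<psi>\<^sub>1 c x u v = 0" "\<psi>\<^sub>2 c x u v = 0" if "c \<in> A" "x \<in> coord_dom c" for c x u v
    using two_form_dim1[OF _ that True] assms(3,4) by (auto simp: conformal_killing_def)
  have z\<phi>: "?\<phi> c x u v = 0" if c: "c \<in> A" "x \<in> coord_dom c" for c x u v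
  proof -
    interpret metric_field "coord_dom c" "g c" by (rule metric_field_chart[OF assms(1) c(1)])
    show ?thesis
      using zero_form(3)[of "\<psi>\<^sub>1 c", OF z(1)[OF c(1)] c(2)] zero_form(3)[of "\<psi>\<^sub>2 c", OF z(2)[OF c(1)] c(2)]
      by (simp add: form_bracket_def)
  qed
  have "two_form A ?\<phi>"
  proof -
    have "smooth_on (coord_dom c) (\<lambda>x. ?\<phi> c x u v)" if c: "c \<in> A" for c u v
    proof -
      interpret metric_field "coord_dom c" "g c" by (rule metric_field_chart[OF assms(1) c])
      show ?thesis by (rule smooth_on_cong[OF S _ smooth_on_const[of _ 0]]) (simp add: z\<phi>[OF c])
    qed
    moreover have "bilinear (?\<phi> c x)" if "c \<in> A" "x \<in> coord_dom c" for c x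
      unfolding bilinear_def by (auto intro!: linearI simp: z\<phi>[OF that])
    moreover have "x \<in> coord_dom c \<and> transition c c' x \<in> coord_dom c'"
      if "c \<in> A" "c' \<in> A" "x \<in> overlap c c'" for c c' x
      using overlap_open(2,3)[OF _ that(1,2)] assms(1) that(3) unfolding riemannian_manifold_def by blast
    ultimately show ?thesis by (simp add: two_form_def tensor2_field_def z\<phi>)
  qed
  moreover have "nabla_form (g c) y (?\<phi> c) x u v = 1 / 3 * ext_deriv (?\<phi> c) x y u v
        - 1 / (real DIM('e) - 1) * wedge (g c) x y (codiff (g c) (?\<phi> c) x) u v \<and>
      codiff (g c) (?\<phi> c) x = lie_bracket (codiff (g c) (\<psi>\<^sub>1 c)) (codiff (g c) (\<psi>\<^sub>2 c)) x"
    if c: "c \<in> A" "x \<in> coord_dom c" for c x y u v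
  proof -
    interpret metric_field "coord_dom c" "g c" by (rule metric_field_chart[OF assms(1) c(1)])
    have zd: "D (codiff (g c) (\<psi> c)) x w = 0" if "\<And>x u v. x \<in> coord_dom c \<Longrightarrow> \<psi> c x u v = 0" for \<psi> w
    proof -
      have "D (codiff (g c) (\<psi> c)) x w = D (\<lambda>_. 0) x w"
        by (rule fun_cong[OF D_cong[OF S c(2)]]) (rule zero_form(4)[OF that])
      then show ?thesis by simp
    qed
    show ?thesis
      using zero_form[of "?\<phi> c", OF z\<phi>[OF c(1)] c(2)] zd[of \<psi>\<^sub>1, OF z(1)[OF c(1)]] zd[of \<psi>\<^sub>2, OF z(2)[OF c(1)]]
      by (simp add: wedge_def lie_bracket_def bilinear_simps[OF G_bil[OF c(2)]])
  qed
  ultimately show ?thesis unfolding conformal_killing_def by blast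
next
  case False
  then have dim: "2 \<le> DIM('e)" using DIM_positive[where 'a = 'e] by linarith
  obtain a where ein: "\<And>c. c \<in> A \<Longrightarrow> \<forall>x\<in>coord_dom c. \<forall>v w. ricci (g c) x v w = a * g c x v w"
    using assms(2) unfolding einstein_def by blast
  let ?\<phi> = "form_bracket g \<psi>\<^sub>1 \<psi>\<^sub>2"
  have two: "two_form A ?\<phi>" by (rule two_form_form_bracket[OF assms(1) dim assms(3,4)])
  have "nabla_form (g c) y (?\<phi> c) x u v = 1 / 3 * ext_deriv (?\<phi> c) x y u v
        - 1 / (real DIM('e) - 1) * wedge (g c) x y (codiff (g c) (?\<phi> c) x) u v \<and>
      codiff (g c) (?\<phi> c) x = lie_bracket (codiff (g c) (\<psi>\<^sub>1 c)) (codiff (g c) (\<psi>\<^sub>2 c)) x"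
    if c: "c \<in> A" and x: "x \<in> coord_dom c" for c x y u v
  proof -
    interpret metric_field "coord_dom c" "g c" by (rule metric_field_chart[OF assms(1) c])
    have form: "form_field (\<psi>\<^sub>1 c)" "form_field (\<psi>\<^sub>2 c)"
      using assms(3,4) form_field_chart[OF assms(1) c] by (auto simp: conformal_killing_def)
    note ck = ck_chart[OF assms(1) c assms(3)] ck_chart[OF assms(1) c assms(4)]
    note sm = ck_smooth[OF form_field(1)[OF form(1)] ck(1) dim] ck_smooth[OF form_field(1)[OF form(2)] ck(2) dim]
    \<comment> \<open>Both claims follow from this: \<open>ck_codiff\<close> identifies the
      codifferential with the bracket, and \<open>ck_imp_conformal\<close> restores the full
      equation.\<close>
    have ck\<phi>: "ck (?\<phi> c) (lie_bracket (codiff (g c) (\<psi>\<^sub>1 c)) (codiff (g c) (\<psi>\<^sub>2 c)))"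
      unfolding form_bracket_eq by (rule bracket_ck[OF form sm ck dim ein[OF c]])
    show ?thesis
      using ck_imp_conformal[OF form_field_chart[OF assms(1) c two] ck\<phi> x] ck_codiff[OF ck\<phi> dim x] by simp
  qed
  with two show ?thesis unfolding conformal_killing_def by blast
qed

end
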